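(* Let $n\geq3$ and let $\rho_{A_1A_2A_3}$ be a state on $H_{A_1}\otimes H_{A_2}\otimes H_{A_3}$ with $\dim H_{A_1}=\dim H_{A_2}=2$, $\dim H_{A_3}=2^{n-2}$. Let $k\geq 1$, $0<q\leq 1$, $0<s\leq 1$, $\beta\geq s$. (1) If $\mathcal N_a^s(\rho_{A_1A_3})\geq k\,\mathcal N_a^s(\rho_{A_1A_2})$, then $$\mathcal N_a^\beta(\rho_{A_1|A_2A_3})\leq q^{\beta/s}\mathcal N_a^\beta(\rho_{A_1A_2})+\frac{(1+k)^{\beta/s}-q^{\beta/s}}{k^{\beta/s}}\mathcal N_a^\beta(\rho_{A_1A_3}).$$ (2) If $\mathcal N_a^s(\rho_{A_1A_2})\geq k\,\mathcal N_a^s(\rho_{A_1A_3})$, then $$\mathcal N_a^\beta(\rho_{A_1|A_2A_3})\leq q^{\beta/s}\mathcal N_a^\beta(\rho_{A_1A_3})+\frac{(1+k)^{\beta/s}-q^{\beta/s}}{k^{\beta/s}}\mathcal N_a^\beta(\rho_{A_1A_2}).$$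
   Context: For a bipartite pure state $|\varphi\rangle_{XY}$, its negativity is $\mathcal N(|\varphi\rangle)=\|(|\varphi\rangle\langle\varphi|)^{T_X}\|_{tr}-1$, where $T_X$ is the partial transpose with respect to $X$ and $\|\cdot\|_{tr}$ is the trace norm (sum of singular values); equivalently $\mathcal N(|\varphi\rangle)=(\mathrm{tr}\sqrt{\rho_X})^2-1$ with $\rho_X=\mathrm{tr}_Y|\varphi\rangle\langle\varphi|$. The (convex-roof extended) negativity of assistance of a bipartite state $\rho_{XY}$ is $\mathcal N_a(\rho_{XY})=\max\sum_ip_i\mathcal N(|\varphi_i\rangle)$, the maximum over all pure-state ensembles $\{p_i,|\varphi_i\rangle\}$ with $\rho_{XY}=\sum_ip_i|\varphi_i\rangle\langle\varphi_i|$. $\rho_{A_1A_2},\rho_{A_1A_3}$ are reduced states, and $\rho_{A_1|A_2A_3}$ is $\rho_{A_1A_2A_3}$ viewed as a bipartite state for the cut $A_1$ versus $A_2A_3$. *)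

theory Defs
  imports "Jordan_Normal_Form.Matrix" Complex_Main
begin

text \<open>Conventions. A system of dimension dA*dB is indexed by a*dB+b (Kronecker order).
A tripartite system of dimensions d1,d2,d3 is indexed by i1*(d2*d3)+i2*d3+i3.\<close>

definition quad_form :: "nat \<Rightarrow> complex mat \<Rightarrow> complex vec \<Rightarrow> complex" where
  "quad_form d A v = (\<Sum>i<d. \<Sum>j<d. cnj (v $ i) * A $$ (i, j) * v $ j)"

definition psd :: "nat \<Rightarrow> complex mat \<Rightarrow> bool" where
  "psd d A \<longleftrightarrow> A \<in> carrier_mat d d \<and>
     (\<forall>v \<in> carrier_vec d. Im (quad_form d A v) = 0 \<and> Re (quad_form d A v) \<ge> 0)"

definition mtrace :: "complex mat \<Rightarrow> complex" where
  "mtrace A = (\<Sum>i<dim_row A. A $$ (i, i))"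

definition density :: "nat \<Rightarrow> complex mat \<Rightarrow> bool" where
  "density d \<rho> \<longleftrightarrow> psd d \<rho> \<and> mtrace \<rho> = 1"

definition mat_sqrt :: "nat \<Rightarrow> complex mat \<Rightarrow> complex mat" where
  "mat_sqrt d A = (THE B. psd d B \<and> B * B = A)"

definition unit_vec :: "nat \<Rightarrow> complex vec \<Rightarrow> bool" where
  "unit_vec d v \<longleftrightarrow> dim_vec v = d \<and> (\<Sum>i<d. (cmod (v $ i))\<^sup>2) = 1"

definition proj :: "complex vec \<Rightarrow> complex mat" where
  "proj v = mat (dim_vec v) (dim_vec v) (\<lambda>(i, j). v $ i * cnj (v $ j))"

definition ptrace_2 :: "nat \<Rightarrow> nat \<Rightarrow> complex mat \<Rightarrow> complex mat" where
  "ptrace_2 dX dY M = mat dX dX (\<lambda>(i, j). \<Sum>b<dY. M $$ (i * dY + b, j * dY + b))"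

definition negativity_pure :: "nat \<Rightarrow> nat \<Rightarrow> complex vec \<Rightarrow> real" where
  "negativity_pure dX dY \<psi> = (Re (mtrace (mat_sqrt dX (ptrace_2 dX dY (proj \<psi>)))))\<^sup>2 - 1"

definition pure_ensemble :: "nat \<Rightarrow> complex mat \<Rightarrow> (real \<times> complex vec) list \<Rightarrow> bool" where
  "pure_ensemble d \<rho> E \<longleftrightarrow>
     (\<forall>(p, \<psi>) \<in> set E. p \<ge> 0 \<and> unit_vec d \<psi>) \<and>
     \<rho> = mat d d (\<lambda>(i, j). \<Sum>(p, \<psi>) \<leftarrow> E. complex_of_real p * \<psi> $ i * cnj (\<psi> $ j))"

definition negativity_assist :: "nat \<Rightarrow> nat \<Rightarrow> complex mat \<Rightarrow> real" where
  "negativity_assist dX dY \<rho> =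
     Sup {(\<Sum>(p, \<psi>) \<leftarrow> E. p * negativity_pure dX dY \<psi>) | E. pure_ensemble (dX * dY) \<rho> E}"

definition reduced_12 :: "nat \<Rightarrow> nat \<Rightarrow> nat \<Rightarrow> complex mat \<Rightarrow> complex mat" where
  "reduced_12 d1 d2 d3 \<rho> = ptrace_2 (d1 * d2) d3 \<rho>"

definition reduced_13 :: "nat \<Rightarrow> nat \<Rightarrow> nat \<Rightarrow> complex mat \<Rightarrow> complex mat" where
  "reduced_13 d1 d2 d3 \<rho> = mat (d1 * d3) (d1 * d3) (\<lambda>(i, j).
     \<Sum>b<d2. \<rho> $$ ((i div d3) * (d2 * d3) + b * d3 + i mod d3,
                    (j div d3) * (d2 * d3) + b * d3 + j mod d3))"

end

theory Submission
  imports Defs "Jordan_Normal_Form.Determinant" "HOL-Analysis.Function_Topology" "HOL-Analysis.L2_Norm"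
begin

text \<open>
  For a qubit \<open>A\<close> the negativity of a pure state is its concurrence, which for an unnormalised
  \<open>|0\<rangle>x + |1\<rangle>y\<close> is a multiple of the norm of \<open>x \<and> y\<close>. When \<open>x, y\<close> lie in
  \<open>B \<otimes> C\<close>, the bivector splits along
  \<open>\<Lambda>\<^sup>2(B \<otimes> C) = (\<Lambda>\<^sup>2B \<otimes> S\<^sup>2C) \<oplus> (S\<^sup>2B \<otimes> \<Lambda>\<^sup>2C)\<close>. Each component is a symmetric
  form on one factor with values in the exterior square of the other, and measuring an orthonormal
  basis of the former factor yields an ensemble on \<open>A\<close> and the latter whose average concurrence is
  the sum of the norms of the diagonal entries of the form. For a basis that maximises this sum it is
  at least the Frobenius norm of the form. Hence the negativity of assistance is subadditive on
  pure states, and on mixed states by concatenating ensembles. The weighted inequality is then a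
  statement about real numbers: \<open>u \<mapsto> (u + 1)\<^sup>m - q\<^sup>m u\<^sup>m\<close> is increasing for \<open>m \<ge> 1\<close> and \<open>q \<le> 1\<close>.
\<close>

section \<open>Inequalities for real powers\<close>

lemma powr_add_minus_powr_mono:
  fixes u v y m c :: real
  assumes "0 \<le> u" "u \<le> v" "0 \<le> y" "1 \<le> m" "c \<le> 1"
  shows "(u + y) powr m - c * u powr m \<le> (v + y) powr m - c * v powr m"
proof (rule DERIV_nonneg_imp_increasing_open[OF \<open>u \<le> v\<close>])
  show "continuous_on {u..v} (\<lambda>x. (x + y) powr m - c * x powr m)"
    using assms by (intro continuous_intros continuous_on_powr') auto
next
  fix x assume "u < x" "x < v"
  then have "0 < x" using assms by simp
  then have "((\<lambda>x. (x + y) powr m - c * x powr m) has_real_derivative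
      m * ((x + y) powr (m - 1) - c * x powr (m - 1))) (at x)"
    using assms by (auto intro!: derivative_eq_intros simp: algebra_simps)
  moreover have "c * x powr (m - 1) \<le> (x + y) powr (m - 1)"
  proof -
    have "c * x powr (m - 1) \<le> 1 * x powr (m - 1)"
      using \<open>c \<le> 1\<close> by (intro mult_right_mono) auto
    also have "\<dots> \<le> (x + y) powr (m - 1)"
      using \<open>0 < x\<close> assms by (auto intro!: powr_mono2)
    finally show ?thesis .
  qed
  ultimately show "\<exists>D. ((\<lambda>x. (x + y) powr m - c * x powr m) has_real_derivative D) (at x) \<and> 0 \<le> D"
    using \<open>1 \<le> m\<close> by (intro exI conjI) auto
qed

lemma powr_superadditive:
  fixes x y m :: real
  assumes "0 \<le> x" "0 \<le> y" "1 \<le> m"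
  shows "x powr m + y powr m \<le> (x + y) powr m"
  using powr_add_minus_powr_mono[of 0 x y m 1] assms by simp

lemma powr_add_le_weighted:
  fixes x y k q m :: real
  assumes "0 \<le> x" "k * x \<le> y" "0 < k" "0 \<le> q" "q \<le> 1" "1 \<le> m"
  shows "(x + y) powr m \<le> q powr m * x powr m + ((1 + k) powr m - q powr m) / k powr m * y powr m"
proof -
  have y_nonneg: "0 \<le> y"
    using assms by (meson mult_nonneg_nonneg less_imp_le order_trans)
  have "(x + y) powr m - q powr m * x powr m \<le> (y / k + y) powr m - q powr m * (y / k) powr m"
    using assms y_nonneg by (intro powr_add_minus_powr_mono powr_le1) (auto simp: field_simps)
  also have "y / k + y = (1 + k) * y / k"
    using \<open>0 < k\<close> by (simp add: field_simps)
  finally have "(x + y) powr m - q powr m * x powr m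
      \<le> (1 + k) powr m * y powr m / k powr m - q powr m * (y powr m / k powr m)"
    using \<open>0 < k\<close> y_nonneg by (simp add: powr_mult powr_divide)
  then show ?thesis
    by (simp add: algebra_simps diff_divide_distrib)
qed

lemma powr_le_weighted_if_le_add:
  fixes x y z k q s \<beta> :: real
  assumes "0 \<le> x" "0 \<le> y" "0 \<le> z" "z \<le> x + y"
    and "0 < k" "0 \<le> q" "q \<le> 1" "0 < s" "s \<le> 1" "s \<le> \<beta>"
    and "k * x powr s \<le> y powr s"
  shows "z powr \<beta> \<le> q powr (\<beta> / s) * x powr \<beta>
           + ((1 + k) powr (\<beta> / s) - q powr (\<beta> / s)) / k powr (\<beta> / s) * y powr \<beta>"
proof -
  have "z \<le> (x powr s) powr (1 / s) + (y powr s) powr (1 / s)"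
    using assms by (simp add: powr_powr)
  also have "\<dots> \<le> (x powr s + y powr s) powr (1 / s)"
    using assms by (intro powr_superadditive) auto
  finally have "z powr \<beta> \<le> ((x powr s + y powr s) powr (1 / s)) powr \<beta>"
    using assms by (intro powr_mono2) auto
  also have "\<dots> = (x powr s + y powr s) powr (\<beta> / s)"
    by (simp add: powr_powr)
  also have "\<dots> \<le> q powr (\<beta> / s) * (x powr s) powr (\<beta> / s)
      + ((1 + k) powr (\<beta> / s) - q powr (\<beta> / s)) / k powr (\<beta> / s) * (y powr s) powr (\<beta> / s)"
    using assms by (intro powr_add_le_weighted) auto
  finally show ?thesis
    using \<open>0 < s\<close> by (simp add: powr_powr)
qed

section \<open>Isometries\<close>

text \<open>The columns are orthonormal; the rows are the vectors of a rank-one measurement.\<close>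

definition isometry :: "nat \<Rightarrow> nat \<Rightarrow> (nat \<Rightarrow> nat \<Rightarrow> complex) \<Rightarrow> bool" where
  "isometry r n U \<longleftrightarrow> (\<forall>i<n. \<forall>j<n. (\<Sum>m<r. cnj (U m i) * U m j) = of_bool (i = j))"

lemma isometry_identity: "isometry n n (\<lambda>m i. of_bool (m = i))"
proof -
  have "(\<Sum>m<n. cnj (of_bool (m = i)) * of_bool (m = j))
      = (\<Sum>m<n. if m = i then of_bool (i = j) else 0 :: complex)" for i j
    by (intro sum.cong) auto
  then show ?thesis by (simp add: isometry_def)
qed

lemma isometry_inner:
  assumes "isometry r n U"
  shows "(\<Sum>m<r. (\<Sum>i<n. U m i * x i) * cnj (\<Sum>i<n. U m i * y i)) = (\<Sum>i<n. x i * cnj (y i))"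
proof -
  have "(\<Sum>m<r. (\<Sum>i<n. U m i * x i) * cnj (\<Sum>i<n. U m i * y i))
      = (\<Sum>m<r. \<Sum>i<n. \<Sum>j<n. x i * cnj (y j) * (cnj (U m j) * U m i))"
    by (simp add: sum_product mult_ac)
  also have "\<dots> = (\<Sum>i<n. \<Sum>j<n. x i * cnj (y j) * (\<Sum>m<r. cnj (U m j) * U m i))"
    by (subst sum.swap, rule sum.cong[OF refl], subst sum.swap) (simp add: sum_distrib_left)
  also have "\<dots> = (\<Sum>i<n. \<Sum>j<n. x i * cnj (y j) * of_bool (j = i))"
    using assms by (simp add: isometry_def)
  finally show ?thesis
    by (simp add: of_bool_def if_distrib cong: if_cong)
qed

lemma of_real_sum_cmod_square: "complex_of_real (\<Sum>i\<in>I. (cmod (f i))\<^sup>2) = (\<Sum>i\<in>I. f i * cnj (f i))"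
  by (simp only: of_real_sum complex_norm_square)

lemma isometry_sum_cmod_square:
  assumes "isometry r n U"
  shows "(\<Sum>m<r. (cmod (\<Sum>i<n. U m i * z i))\<^sup>2) = (\<Sum>i<n. (cmod (z i))\<^sup>2)"
  using isometry_inner[OF assms, of z z] unfolding of_real_sum_cmod_square[symmetric] of_real_eq_iff .

lemma isometry_cmod_le:
  assumes "isometry r n U" "m < r" "i < n"
  shows "cmod (U m i) \<le> 1"
proof -
  have "complex_of_real (\<Sum>m<r. (cmod (U m i))\<^sup>2) = of_real 1"
    using assms unfolding of_real_sum_cmod_square by (simp add: isometry_def mult.commute)
  then have "(\<Sum>m<r. (cmod (U m i))\<^sup>2) = 1"
    unfolding of_real_eq_iff .
  moreover have "(cmod (U m i))\<^sup>2 \<le> (\<Sum>m<r. (cmod (U m i))\<^sup>2)"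
    using \<open>m < r\<close> by (intro member_le_sum) auto
  ultimately show ?thesis by (simp add: power_le_one_iff)
qed

lemma isometry_rotate:
  fixes c s :: real
  assumes "isometry r n U" "k < r" "l < r" "k \<noteq> l" "c\<^sup>2 + s\<^sup>2 = 1"
  shows "isometry r n (U(k := \<lambda>i. complex_of_real c * U k i + complex_of_real s * U l i,
    l := \<lambda>i. complex_of_real s * U k i - complex_of_real c * U l i))"
    (is "isometry r n ?V")
proof -
  have unit: "complex_of_real c * c + complex_of_real s * s = 1"
    using assms(5) by (metis of_real_1 of_real_add of_real_mult power2_eq_square)
  have "cnj (?V k i) * ?V k j + cnj (?V l i) * ?V l j
      = (complex_of_real c * c + complex_of_real s * s) * (cnj (U k i) * U k j + cnj (U l i) * U l j)"
    for i j
    using assms(4) by (simp add: algebra_simps)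
  then have pair: "(\<Sum>m\<in>{k, l}. cnj (?V m i) * ?V m j) = (\<Sum>m\<in>{k, l}. cnj (U m i) * U m j)" for i j
    using assms(4) by (simp add: unit)
  have "(\<Sum>m<r. cnj (?V m i) * ?V m j) = (\<Sum>m<r. cnj (U m i) * U m j)" for i j
    using assms(2,3) pair
    by (subst (1 2) sum.subset_diff[of "{k, l}"]) (auto intro!: arg_cong2[of _ _ _ _ plus] sum.cong)
  then show ?thesis using assms(1) by (simp add: isometry_def)
qed

lemma compact_isometries:
  "compact {U. isometry r n U \<and> (\<forall>m i. \<not> (m < r \<and> i < n) \<longrightarrow> U m i = 0)}" (is "compact ?S")
proof -
  define square where "square = (\<lambda>(a, b). Complex a b) ` ({-1..1} \<times> {-1..1})"
  let ?B = "PiE UNIV (\<lambda>_. PiE UNIV (\<lambda>_. square)) :: (nat \<Rightarrow> nat \<Rightarrow> complex) set"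
  have "compact square"
    unfolding square_def Complex_eq
    by (intro compact_continuous_image compact_Times compact_Icc)
      (auto simp: case_prod_unfold intro!: continuous_intros)
  have compact_PiE: "compact (PiE UNIV S)" if "\<And>i. compact (S i)"
    for S :: "nat \<Rightarrow> 'x :: topological_space set"
    using that compactin_PiE[of "\<lambda>_. euclidean" UNIV S] by (simp add: euclidean_product_topology)
  have coord: "continuous_on UNIV (\<lambda>U :: nat \<Rightarrow> nat \<Rightarrow> complex. U m i)" for m i
    by (rule continuous_on_product_then_coordinatewise
        [OF continuous_on_product_then_coordinatewise[OF continuous_on_id]])
  have "?S = (\<Inter>i\<in>{..<n}. \<Inter>j\<in>{..<n}. {U. (\<Sum>m<r. cnj (U m i) * U m j) = of_bool (i = j)})
      \<inter> (\<Inter>(m, i)\<in>{(m, i). \<not> (m < r \<and> i < n)}. {U. U m i = 0})"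
    by (auto simp: isometry_def)
  also have "closed \<dots>"
    by (intro closed_Int closed_INT ballI) (auto intro!: closed_Collect_eq continuous_intros coord)
  finally have "compact (?S \<inter> ?B)"
    by (intro closed_Int_compact compact_PiE \<open>compact square\<close>)
  moreover have "?S \<subseteq> ?B"
  proof
    fix U assume U: "U \<in> ?S"
    have "U m i \<in> square" for m i
    proof -
      have "cmod (U m i) \<le> 1"
        using U isometry_cmod_le[of r n U m i] by (cases "m < r \<and> i < n") auto
      then have "\<bar>Re (U m i)\<bar> \<le> 1" "\<bar>Im (U m i)\<bar> \<le> 1"
        using abs_Re_le_cmod[of "U m i"] abs_Im_le_cmod[of "U m i"] by linarith+
      then show ?thesis
        unfolding square_def by (intro image_eqI[of _ _ "(Re (U m i), Im (U m i))"]) auto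
    qed
    then show "U \<in> ?B" by (simp add: PiE_iff)
  qed
  ultimately show ?thesis
    by (simp only: Int_absorb2)
qed

lemma isometry_attains_sup:
  fixes F :: "(nat \<Rightarrow> nat \<Rightarrow> complex) \<Rightarrow> real"
  assumes "continuous_on UNIV F"
    and local: "\<And>U V. (\<And>m i. m < n \<Longrightarrow> i < n \<Longrightarrow> U m i = V m i) \<Longrightarrow> F U = F V"
  obtains U where "isometry n n U" "\<And>V. isometry n n V \<Longrightarrow> F V \<le> F U"
proof -
  define cut :: "(nat \<Rightarrow> nat \<Rightarrow> complex) \<Rightarrow> nat \<Rightarrow> nat \<Rightarrow> complex"
    where "cut V m i = (if m < n \<and> i < n then V m i else 0)" for V m i
  let ?S = "{U. isometry n n U \<and> (\<forall>m i. \<not> (m < n \<and> i < n) \<longrightarrow> U m i = 0)}"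
  have cut: "cut V \<in> ?S" if "isometry n n V" for V
    using that by (auto simp: isometry_def cut_def)
  then have "?S \<noteq> {}"
    using isometry_identity by blast
  moreover have "continuous_on ?S F"
    using assms(1) by (rule continuous_on_subset) simp
  ultimately have "\<exists>U\<in>?S. \<forall>V\<in>?S. F V \<le> F U"
    by (rule continuous_attains_sup[OF compact_isometries])
  then obtain U where U: "U \<in> ?S" and max: "\<And>V. V \<in> ?S \<Longrightarrow> F V \<le> F U"
    by blast
  show ?thesis
  proof (rule that)
    show "isometry n n U" using U by simp
    fix V assume V: "isometry n n V"
    have "F V = F (cut V)" by (rule local) (simp add: cut_def)
    also have "\<dots> \<le> F U" using cut[OF V] by (rule max)
    finally show "F V \<le> F U" .
  qed
qed

section \<open>Symmetric bilinear forms with values in a Hilbert space\<close>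

abbreviation l2norm :: "'i set \<Rightarrow> ('i \<Rightarrow> complex) \<Rightarrow> real" where
  "l2norm I f \<equiv> L2_set (\<lambda>i. cmod (f i)) I"

lemma l2norm_power2: "(l2norm I f)\<^sup>2 = (\<Sum>i\<in>I. (cmod (f i))\<^sup>2)"
  by (simp add: L2_set_def sum_nonneg)

lemma l2norm_triangle: "l2norm I (\<lambda>i. f i + g i) \<le> l2norm I f + l2norm I g"
proof -
  have "l2norm I (\<lambda>i. f i + g i) \<le> L2_set (\<lambda>i. cmod (f i) + cmod (g i)) I"
    by (intro L2_set_mono norm_triangle_ineq norm_ge_zero)
  also have "\<dots> \<le> l2norm I f + l2norm I g"
    by (rule L2_set_triangle_ineq)
  finally show ?thesis .
qed

lemma l2norm_scale: "l2norm I (\<lambda>i. a * f i) = cmod a * l2norm I f"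
  by (simp add: norm_mult L2_set_right_distrib)

lemma l2norm_reindex: "bij_betw h A B \<Longrightarrow> l2norm A (\<lambda>a. f (h a)) = l2norm B f"
  unfolding L2_set_def by (intro arg_cong[of _ _ sqrt] sum.reindex_bij_betw)

definition form_value ::
  "nat \<Rightarrow> (nat \<Rightarrow> nat \<Rightarrow> complex) \<Rightarrow> (nat \<Rightarrow> complex) \<Rightarrow> (nat \<Rightarrow> complex) \<Rightarrow> complex" where
  "form_value n T x y = (\<Sum>i<n. \<Sum>j<n. x i * y j * T i j)"

lemma form_value_symmetrize: "form_value n (\<lambda>i j. (T i j + T j i) / 2) u u = form_value n T u u"
proof -
  have "form_value n (\<lambda>i j. (T i j + T j i) / 2) u u
      = (form_value n T u u + (\<Sum>i<n. \<Sum>j<n. u i * u j * T j i)) / 2"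
    by (simp add: form_value_def distrib_left sum.distrib flip: sum_divide_distrib)
  also have "(\<Sum>i<n. \<Sum>j<n. u i * u j * T j i) = form_value n T u u"
    unfolding form_value_def by (subst sum.swap) (simp add: mult.commute)
  finally show ?thesis by simp
qed

text \<open>Let \<open>p\<close>, \<open>q\<close> be the diagonal entries and \<open>r\<close> the off-diagonal entry of a symmetric form. In the
  orthonormal basis \<open>(c, s)\<close>, \<open>(s, - c)\<close> it has the diagonal entries \<open>rotate_diag c s p r q\<close> and
  \<open>rotate_diag s (- c) p r q\<close>.\<close>

definition rotate_diag :: "real \<Rightarrow> real \<Rightarrow> complex \<Rightarrow> complex \<Rightarrow> complex \<Rightarrow> complex" where
  "rotate_diag c s p r q = of_real (c\<^sup>2) * p + of_real (2 * c * s) * r + of_real (s\<^sup>2) * q"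

definition rotate_offdiag :: "real \<Rightarrow> real \<Rightarrow> complex \<Rightarrow> complex \<Rightarrow> complex \<Rightarrow> complex" where
  "rotate_offdiag c s p r q = of_real (c * s) * (p - q) + of_real (s\<^sup>2 - c\<^sup>2) * r"

lemma rotate_diag_equal:
  fixes p q r :: "'i \<Rightarrow> complex"
  obtains c s :: real where "c\<^sup>2 + s\<^sup>2 = 1"
    "l2norm I (\<lambda>i. rotate_diag c s (p i) (r i) (q i))
      = l2norm I (\<lambda>i. rotate_diag s (- c) (p i) (r i) (q i))"
proof -
  define f where "f t = l2norm I (\<lambda>i. rotate_diag (cos t) (sin t) (p i) (r i) (q i))
    - l2norm I (\<lambda>i. rotate_diag (sin t) (- cos t) (p i) (r i) (q i))" for t
  have "continuous_on {0..pi/2} f"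
    unfolding f_def rotate_diag_def L2_set_def by (intro continuous_intros)
  moreover have "f (pi/2) = - f 0"
    by (simp add: f_def rotate_diag_def)
  ultimately have "\<exists>t. f t = 0"
    using IVT'[of f 0 0 "pi/2"] IVT2'[of f "pi/2" 0 0] by (cases "f 0 \<le> 0") fastforce+
  then obtain t where "f t = 0" by blast
  then show ?thesis
    by (intro that[of "cos t" "sin t"]) (auto simp: f_def)
qed

lemma rotate_frobenius:
  fixes c s :: real
  assumes "c\<^sup>2 + s\<^sup>2 = 1"
  shows "(cmod (rotate_diag c s p r q))\<^sup>2 + (cmod (rotate_diag s (- c) p r q))\<^sup>2
      + 2 * (cmod (rotate_offdiag c s p r q))\<^sup>2
    = (cmod p)\<^sup>2 + (cmod q)\<^sup>2 + 2 * (cmod r)\<^sup>2"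
proof -
  have real_case: "(c\<^sup>2 * x + 2 * c * s * z + s\<^sup>2 * y)\<^sup>2 + (s\<^sup>2 * x - 2 * c * s * z + c\<^sup>2 * y)\<^sup>2
      + 2 * (c * s * (x - y) + (s\<^sup>2 - c\<^sup>2) * z)\<^sup>2 = x\<^sup>2 + y\<^sup>2 + 2 * z\<^sup>2" for x y z :: real
  proof -
    have "(c\<^sup>2 * x + 2 * c * s * z + s\<^sup>2 * y)\<^sup>2 + (s\<^sup>2 * x - 2 * c * s * z + c\<^sup>2 * y)\<^sup>2
      + 2 * (c * s * (x - y) + (s\<^sup>2 - c\<^sup>2) * z)\<^sup>2 = (c\<^sup>2 + s\<^sup>2)\<^sup>2 * (x\<^sup>2 + y\<^sup>2 + 2 * z\<^sup>2)"
      by (simp add: power2_eq_square algebra_simps)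
    then show ?thesis by (simp add: assms)
  qed
  show ?thesis
    using real_case[of "Re p" "Re r" "Re q"] real_case[of "Im p" "Im r" "Im q"]
    by (simp add: cmod_power2 rotate_diag_def rotate_offdiag_def mult_ac
        del: of_real_mult of_real_power of_real_diff)
qed

text \<open>The witnesses rotate by a further eighth of a turn.\<close>

lemma double_rotate_offdiag:
  fixes c s :: real
  assumes "c\<^sup>2 + s\<^sup>2 = 1"
  obtains c' s' :: real where "c'\<^sup>2 + s'\<^sup>2 = 1"
    "\<And>p r q. 2 * rotate_offdiag c s p r q = rotate_diag s' (- c') p r q + - rotate_diag c' s' p r q"
proof -
  define c' s' where "c' = (c - s) / sqrt 2" and "s' = (c + s) / sqrt 2"
  have squares: "c'\<^sup>2 = (1 - 2 * c * s) / 2" "s'\<^sup>2 = (1 + 2 * c * s) / 2"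
    and product: "2 * c' * s' = c\<^sup>2 - s\<^sup>2" "2 * s' * - c' = - (c\<^sup>2 - s\<^sup>2)"
    using assms by (auto simp: c'_def s'_def power_divide power2_eq_square field_simps)
  have "2 * rotate_offdiag c s p r q = rotate_diag s' (- c') p r q + - rotate_diag c' s' p r q"
    for p r q
    unfolding rotate_diag_def rotate_offdiag_def power2_minus squares product by (simp add: field_simps)
  moreover have "c'\<^sup>2 + s'\<^sup>2 = 1"
    by (simp add: squares field_simps)
  ultimately show ?thesis using that by blast
qed

lemma rotation_optimal_imp_offdiag_le:
  fixes p q r :: "'i \<Rightarrow> complex"
  assumes optimal: "\<And>c s :: real. c\<^sup>2 + s\<^sup>2 = 1 \<Longrightarrow>
      l2norm I (\<lambda>i. rotate_diag c s (p i) (r i) (q i))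
        + l2norm I (\<lambda>i. rotate_diag s (- c) (p i) (r i) (q i))
      \<le> l2norm I p + l2norm I q"
  shows "(l2norm I r)\<^sup>2 \<le> l2norm I p * l2norm I q"
proof -
  obtain c s :: real where unit: "c\<^sup>2 + s\<^sup>2 = 1" and equal:
    "l2norm I (\<lambda>i. rotate_diag c s (p i) (r i) (q i))
      = l2norm I (\<lambda>i. rotate_diag s (- c) (p i) (r i) (q i))"
    by (rule rotate_diag_equal)
  define d e where "d = l2norm I (\<lambda>i. rotate_diag c s (p i) (r i) (q i))"
    and "e = l2norm I (\<lambda>i. rotate_offdiag c s (p i) (r i) (q i))"
  have "2 * d \<le> l2norm I p + l2norm I q"
    using optimal[OF unit] equal by (simp add: d_def)
  moreover have "2 * e \<le> l2norm I p + l2norm I q"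
  proof -
    obtain c' s' :: real where unit': "c'\<^sup>2 + s'\<^sup>2 = 1" and double:
      "\<And>p r q. 2 * rotate_offdiag c s p r q = rotate_diag s' (- c') p r q + - rotate_diag c' s' p r q"
      using double_rotate_offdiag[OF unit] by blast
    have "2 * e = l2norm I (\<lambda>i. 2 * rotate_offdiag c s (p i) (r i) (q i))"
      unfolding l2norm_scale e_def by simp
    also have "\<dots> \<le> l2norm I (\<lambda>i. rotate_diag s' (- c') (p i) (r i) (q i))
        + l2norm I (\<lambda>i. rotate_diag c' s' (p i) (r i) (q i))"
      unfolding double by (rule order_trans[OF l2norm_triangle]) simp
    also have "\<dots> \<le> l2norm I p + l2norm I q"
      using optimal[OF unit'] by (simp add: add.commute)
    finally show ?thesis .
  qed
  ultimately have "(2 * d)\<^sup>2 + (2 * e)\<^sup>2 \<le> 2 * (l2norm I p + l2norm I q)\<^sup>2"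
    using power_mono[of "2 * d" _ 2] power_mono[of "2 * e" _ 2] by (fastforce simp: d_def e_def)
  moreover have "2 * d\<^sup>2 + 2 * e\<^sup>2 = (l2norm I p)\<^sup>2 + (l2norm I q)\<^sup>2 + 2 * (l2norm I r)\<^sup>2"
  proof -
    have "d\<^sup>2 + (l2norm I (\<lambda>i. rotate_diag s (- c) (p i) (r i) (q i)))\<^sup>2 + 2 * e\<^sup>2
        = (l2norm I p)\<^sup>2 + (l2norm I q)\<^sup>2 + 2 * (l2norm I r)\<^sup>2"
      unfolding d_def e_def l2norm_power2 sum_distrib_left sum.distrib[symmetric]
        rotate_frobenius[OF unit] ..
    then show ?thesis by (simp add: d_def equal)
  qed
  ultimately show ?thesis
    by (simp add: power2_eq_square algebra_simps)
qed

lemma isometry_form_value_frobenius: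
  assumes "isometry r n U"
  shows "(\<Sum>m<r. \<Sum>l<r. (cmod (form_value n T (U m) (U l)))\<^sup>2) = (\<Sum>i<n. \<Sum>j<n. (cmod (T i j))\<^sup>2)"
proof -
  have "form_value n T (U m) (U l) = (\<Sum>i<n. U m i * (\<Sum>j<n. U l j * T i j))" for m l
    by (simp add: form_value_def sum_distrib_left mult_ac)
  then have "(\<Sum>m<r. \<Sum>l<r. (cmod (form_value n T (U m) (U l)))\<^sup>2)
      = (\<Sum>l<r. \<Sum>m<r. (cmod (\<Sum>i<n. U m i * (\<Sum>j<n. U l j * T i j)))\<^sup>2)"
    by (simp only:) (rule sum.swap)
  also have "\<dots> = (\<Sum>l<r. \<Sum>i<n. (cmod (\<Sum>j<n. U l j * T i j))\<^sup>2)"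
    by (simp only: isometry_sum_cmod_square[OF assms])
  also have "\<dots> = (\<Sum>i<n. \<Sum>l<r. (cmod (\<Sum>j<n. U l j * T i j))\<^sup>2)"
    by (rule sum.swap)
  also have "\<dots> = (\<Sum>i<n. \<Sum>j<n. (cmod (T i j))\<^sup>2)"
    by (simp only: isometry_sum_cmod_square[OF assms])
  finally show ?thesis .
qed

lemma form_value_rotate:
  assumes "\<And>i j. T i j = T j i"
  shows "form_value n T (\<lambda>i. of_real c * x i + of_real s * y i) (\<lambda>i. of_real c * x i + of_real s * y i)
    = rotate_diag c s (form_value n T x x) (form_value n T x y) (form_value n T y y)"
proof -
  have swap: "form_value n T y x = form_value n T x y"
    unfolding form_value_def by (subst sum.swap) (simp add: assms mult_ac)
  have "form_value n T (\<lambda>i. of_real c * x i + of_real s * y i) (\<lambda>i. of_real c * x i + of_real s * y i)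
      = of_real (c\<^sup>2) * form_value n T x x + of_real (c * s) * form_value n T x y
        + of_real (c * s) * form_value n T y x + of_real (s\<^sup>2) * form_value n T y y"
    unfolding form_value_def sum_distrib_left sum.distrib[symmetric]
    by (intro sum.cong refl) (simp add: power2_eq_square algebra_simps)
  then show ?thesis
    by (simp add: swap rotate_diag_def algebra_simps)
qed

definition diag_norm :: "'i set \<Rightarrow> nat \<Rightarrow> ('i \<Rightarrow> nat \<Rightarrow> nat \<Rightarrow> complex) \<Rightarrow> (nat \<Rightarrow> complex) \<Rightarrow> real" where
  "diag_norm I n T x = l2norm I (\<lambda>a. form_value n (T a) x x)"

lemma isometry_maximizes_diag_norm:
  obtains U where "isometry n n U"
    "\<And>V. isometry n n V \<Longrightarrow> (\<Sum>m<n. diag_norm I n T (V m)) \<le> (\<Sum>m<n. diag_norm I n T (U m))"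
proof -
  have continuous: "continuous_on UNIV (\<lambda>U. \<Sum>m<n. diag_norm I n T (U m))"
    unfolding diag_norm_def form_value_def L2_set_def
    by (intro continuous_intros continuous_on_product_then_coordinatewise
        [OF continuous_on_product_then_coordinatewise[OF continuous_on_id]])
  have local: "(\<Sum>m<n. diag_norm I n T (U m)) = (\<Sum>m<n. diag_norm I n T (V m))"
    if "\<And>m i. m < n \<Longrightarrow> i < n \<Longrightarrow> U m i = V m i" for U V
    unfolding diag_norm_def form_value_def
    using that by (intro sum.cong L2_set_cong arg_cong[of _ _ cmod]) auto
  show ?thesis
    using isometry_attains_sup[where F = "\<lambda>U. \<Sum>m<n. diag_norm I n T (U m)", OF continuous local] that
    by blast
qed

lemma form_value_le_diag_norm_of_maximal:
  assumes sym: "\<And>a i j. T a i j = T a j i" and U: "isometry n n U" and bounds: "k < n" "l < n"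
    and maximal: "\<And>V. isometry n n V \<Longrightarrow> (\<Sum>m<n. diag_norm I n T (V m)) \<le> (\<Sum>m<n. diag_norm I n T (U m))"
  shows "(l2norm I (\<lambda>a. form_value n (T a) (U k) (U l)))\<^sup>2
    \<le> diag_norm I n T (U k) * diag_norm I n T (U l)"
proof (cases "k = l")
  case True
  then show ?thesis by (simp add: diag_norm_def power2_eq_square)
next
  case False
  have "diag_norm I n T (\<lambda>i. of_real c * U k i + of_real s * U l i)
      + diag_norm I n T (\<lambda>i. of_real s * U k i + of_real (- c) * U l i)
      \<le> diag_norm I n T (U k) + diag_norm I n T (U l)" if "c\<^sup>2 + s\<^sup>2 = 1" for c s :: real
  proof -
    have "(\<Sum>m<n. diag_norm I n T (W m)) = diag_norm I n T (W k)
        + (diag_norm I n T (W l) + (\<Sum>m\<in>{..<n} - {k} - {l}. diag_norm I n T (W m)))" for W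
      using bounds False by (simp add: sum.remove[of _ k] sum.remove[of _ l])
    then show ?thesis
      using maximal[OF isometry_rotate[OF U bounds False that]] False by simp
  qed
  then show ?thesis
    unfolding diag_norm_def form_value_rotate[OF sym] by (rule rotation_optimal_imp_offdiag_le)
qed

lemma symmetric_form_frobenius_le_diag_norm:
  assumes "\<And>a i j. T a i j = T a j i"
  obtains U where "isometry n n U"
    "sqrt (\<Sum>a\<in>I. \<Sum>i<n. \<Sum>j<n. (cmod (T a i j))\<^sup>2) \<le> (\<Sum>m<n. diag_norm I n T (U m))"
proof -
  obtain U where U: "isometry n n U" and maximal:
    "\<And>V. isometry n n V \<Longrightarrow> (\<Sum>m<n. diag_norm I n T (V m)) \<le> (\<Sum>m<n. diag_norm I n T (U m))"
    using isometry_maximizes_diag_norm[of n I T] by blast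
  have "(\<Sum>a\<in>I. \<Sum>i<n. \<Sum>j<n. (cmod (T a i j))\<^sup>2)
      = (\<Sum>a\<in>I. \<Sum>k<n. \<Sum>l<n. (cmod (form_value n (T a) (U k) (U l)))\<^sup>2)"
    by (simp only: isometry_form_value_frobenius[OF U])
  also have "\<dots> = (\<Sum>k<n. \<Sum>l<n. (l2norm I (\<lambda>a. form_value n (T a) (U k) (U l)))\<^sup>2)"
    unfolding l2norm_power2 by (subst sum.swap, rule sum.cong[OF refl], rule sum.swap)
  also have "\<dots> \<le> (\<Sum>k<n. \<Sum>l<n. diag_norm I n T (U k) * diag_norm I n T (U l))"
    using form_value_le_diag_norm_of_maximal[OF assms U _ _ maximal] by (intro sum_mono) auto
  also have "\<dots> = (\<Sum>m<n. diag_norm I n T (U m))\<^sup>2"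
    by (simp add: power2_eq_square sum_product)
  finally have "sqrt (\<Sum>a\<in>I. \<Sum>i<n. \<Sum>j<n. (cmod (T a i j))\<^sup>2) \<le> (\<Sum>m<n. diag_norm I n T (U m))"
    by (intro real_le_lsqrt sum_nonneg) (auto simp: diag_norm_def)
  with U show ?thesis by (rule that)
qed

section \<open>Concurrence\<close>

definition concurrence :: "'i set \<Rightarrow> ('i \<Rightarrow> complex) \<Rightarrow> ('i \<Rightarrow> complex) \<Rightarrow> real" where
  "concurrence J x y = sqrt 2 * l2norm (J \<times> J) (\<lambda>(i, j). x i * y j - x j * y i)"

lemma concurrence_nonneg: "0 \<le> concurrence J x y"
  by (simp add: concurrence_def)

lemma concurrence_cong:
  assumes "\<And>i. i \<in> J \<Longrightarrow> x i = x' i" "\<And>i. i \<in> J \<Longrightarrow> y i = y' i"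
  shows "concurrence J x y = concurrence J x' y'"
  unfolding concurrence_def using assms by (intro arg_cong[of _ _ "(*) (sqrt 2)"] L2_set_cong) auto

lemma concurrence_scale: "concurrence J (\<lambda>i. a * x i) (\<lambda>i. a * y i) = (cmod a)\<^sup>2 * concurrence J x y"
proof -
  have "(\<lambda>(i, j). a * x i * (a * y j) - a * x j * (a * y i))
      = (\<lambda>p. a\<^sup>2 * (\<lambda>(i, j). x i * y j - x j * y i) p)"
    by (auto simp: power2_eq_square algebra_simps)
  then show ?thesis
    by (simp only: concurrence_def l2norm_scale norm_power mult.left_commute)
qed

lemma concurrence_reindex:
  assumes "bij_betw h J K"
  shows "concurrence J (\<lambda>i. x (h i)) (\<lambda>i. y (h i)) = concurrence K x y"
proof -
  have "bij_betw (map_prod h h) (J \<times> J) (K \<times> K)"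
    by (intro bij_betw_map_prod assms)
  from l2norm_reindex[OF this, of "\<lambda>(i, j). x i * y j - x j * y i"] show ?thesis
    by (simp add: concurrence_def case_prod_unfold)
qed

text \<open>The bivector \<open>x \<and> y\<close> of vectors in \<open>B \<otimes> C\<close> has components in \<open>\<Lambda>\<^sup>2B \<otimes> S\<^sup>2C\<close> and
  \<open>S\<^sup>2B \<otimes> \<Lambda>\<^sup>2C\<close>; this is the former.\<close>

definition wedge_sym :: "('b \<Rightarrow> 'c \<Rightarrow> complex) \<Rightarrow> ('b \<Rightarrow> 'c \<Rightarrow> complex) \<Rightarrow> 'b \<times> 'b \<Rightarrow> 'c \<Rightarrow> 'c \<Rightarrow> complex" where
  "wedge_sym x y = (\<lambda>(b, b') c c'.
     ((x b c * y b' c' - x b' c' * y b c) + (x b c' * y b' c - x b' c * y b c')) / 2)"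

lemma wedge_sym_commute: "wedge_sym x y p c c' = wedge_sym x y p c' c"
  by (simp add: wedge_sym_def split: prod.split)

lemma wedge_eq_wedge_sym_add:
  "x b c * y b' c' - x b' c' * y b c
    = wedge_sym x y (b, b') c c' + wedge_sym (\<lambda>c b. x b c) (\<lambda>c b. y b c) (c, c') b b'"
  by (simp add: wedge_sym_def field_simps)

lemma form_value_wedge_sym:
  "form_value n (wedge_sym x y (b, b')) u u
    = (\<Sum>c<n. u c * x b c) * (\<Sum>c<n. u c * y b' c) - (\<Sum>c<n. u c * x b' c) * (\<Sum>c<n. u c * y b c)"
proof -
  have "form_value n (wedge_sym x y (b, b')) u u
      = form_value n (\<lambda>c c'. x b c * y b' c' - x b' c' * y b c) u u"
    using form_value_symmetrize[of n "\<lambda>c c'. x b c * y b' c' - x b' c' * y b c" u]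
    by (simp add: wedge_sym_def)
  also have "\<dots> = (\<Sum>c<n. \<Sum>c'<n. (u c * x b c) * (u c' * y b' c'))
      - (\<Sum>c<n. \<Sum>c'<n. (u c * y b c) * (u c' * x b' c'))"
    by (simp add: form_value_def algebra_simps sum_subtractf)
  finally show ?thesis
    unfolding sum_product[symmetric] by (simp only: mult.commute)
qed

lemma wedge_sym_le_concurrence_contraction:
  fixes x y :: "'b \<Rightarrow> nat \<Rightarrow> complex"
  obtains U where "isometry n n U"
    "sqrt 2 * l2norm ((B \<times> B) \<times> ({..<n} \<times> {..<n})) (\<lambda>(p, c, c'). wedge_sym x y p c c')
      \<le> (\<Sum>m<n. concurrence B (\<lambda>b. \<Sum>c<n. U m c * x b c) (\<lambda>b. \<Sum>c<n. U m c * y b c))"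
proof -
  obtain U where U: "isometry n n U" and frobenius_le:
    "sqrt (\<Sum>p\<in>B \<times> B. \<Sum>c<n. \<Sum>c'<n. (cmod (wedge_sym x y p c c'))\<^sup>2)
      \<le> (\<Sum>m<n. diag_norm (B \<times> B) n (wedge_sym x y) (U m))"
    using symmetric_form_frobenius_le_diag_norm[of "wedge_sym x y", OF wedge_sym_commute] by blast
  have "l2norm ((B \<times> B) \<times> ({..<n} \<times> {..<n})) (\<lambda>(p, c, c'). wedge_sym x y p c c')
      = sqrt (\<Sum>p\<in>B \<times> B. \<Sum>c<n. \<Sum>c'<n. (cmod (wedge_sym x y p c c'))\<^sup>2)"
    by (simp add: L2_set_def sum.cartesian_product case_prod_unfold)
  moreover have "sqrt 2 * diag_norm (B \<times> B) n (wedge_sym x y) u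
      = concurrence B (\<lambda>b. \<Sum>c<n. u c * x b c) (\<lambda>b. \<Sum>c<n. u c * y b c)" for u
    unfolding concurrence_def diag_norm_def by (auto intro!: L2_set_cong simp: form_value_wedge_sym)
  ultimately show ?thesis
    using that[OF U] mult_left_mono[OF frobenius_le, of "sqrt 2"] by (simp add: sum_distrib_left)
qed

lemma concurrence_product_le_wedge_sym:
  "concurrence (B \<times> C) (\<lambda>(b, c). x b c) (\<lambda>(b, c). y b c)
    \<le> sqrt 2 * l2norm ((B \<times> B) \<times> (C \<times> C)) (\<lambda>(p, c, c'). wedge_sym x y p c c')
      + sqrt 2 * l2norm ((C \<times> C) \<times> (B \<times> B))
          (\<lambda>(q, b, b'). wedge_sym (\<lambda>c b. x b c) (\<lambda>c b. y b c) q b b')"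
proof -
  let ?B = "B \<times> B" and ?C = "C \<times> C" and ?BC = "B \<times> C"
  let ?sym = "\<lambda>(p, c, c'). wedge_sym x y p c c'"
    and ?sym' = "\<lambda>(q, b, b'). wedge_sym (\<lambda>c b. x b c) (\<lambda>c b. y b c) q b b'"
  have "bij_betw (\<lambda>((b, b'), (c, c')). ((b, c), (b', c'))) (?B \<times> ?C) (?BC \<times> ?BC)"
    by (rule bij_betwI[where g = "\<lambda>((b, c), (b', c')). ((b, b'), (c, c'))"]) auto
  from l2norm_reindex[OF this, of "\<lambda>((b, c), (b', c')). x b c * y b' c' - x b' c' * y b c"]
  have "l2norm (?BC \<times> ?BC) (\<lambda>((b, c), (b', c')). x b c * y b' c' - x b' c' * y b c)
      = l2norm (?B \<times> ?C) (\<lambda>((b, b'), (c, c')). x b c * y b' c' - x b' c' * y b c)"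
    by (simp add: case_prod_unfold)
  also have "\<dots> = l2norm (?B \<times> ?C) (\<lambda>z. ?sym z + ?sym' (prod.swap z))"
    by (intro L2_set_cong) (auto simp: wedge_eq_wedge_sym_add)
  also have "\<dots> \<le> l2norm (?B \<times> ?C) ?sym + l2norm (?B \<times> ?C) (\<lambda>z. ?sym' (prod.swap z))"
    by (rule l2norm_triangle)
  also have "l2norm (?B \<times> ?C) (\<lambda>z. ?sym' (prod.swap z)) = l2norm (?C \<times> ?B) ?sym'"
    by (rule l2norm_reindex, rule bij_betwI[where g = prod.swap]) auto
  finally show ?thesis
    by (simp add: concurrence_def case_prod_unfold flip: distrib_left)
qed

lemma concurrence_tripartite_le:
  fixes x y :: "nat \<Rightarrow> nat \<Rightarrow> complex"
  obtains U W where "isometry n n U" "isometry m m W"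
    "concurrence ({..<m} \<times> {..<n}) (\<lambda>(b, c). x b c) (\<lambda>(b, c). y b c)
      \<le> (\<Sum>k<n. concurrence {..<m} (\<lambda>b. \<Sum>c<n. U k c * x b c) (\<lambda>b. \<Sum>c<n. U k c * y b c))
        + (\<Sum>k<m. concurrence {..<n} (\<lambda>c. \<Sum>b<m. W k b * x b c) (\<lambda>c. \<Sum>b<m. W k b * y b c))"
proof -
  let ?B = "{..<m} \<times> {..<m}" and ?C = "{..<n} \<times> {..<n}"
  obtain U where U: "isometry n n U" and U_le:
    "sqrt 2 * l2norm (?B \<times> ?C) (\<lambda>(p, c, c'). wedge_sym x y p c c')
      \<le> (\<Sum>k<n. concurrence {..<m} (\<lambda>b. \<Sum>c<n. U k c * x b c) (\<lambda>b. \<Sum>c<n. U k c * y b c))"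
    by (rule wedge_sym_le_concurrence_contraction)
  obtain W where W: "isometry m m W" and W_le:
    "sqrt 2 * l2norm (?C \<times> ?B) (\<lambda>(q, b, b'). wedge_sym (\<lambda>c b. x b c) (\<lambda>c b. y b c) q b b')
      \<le> (\<Sum>k<m. concurrence {..<n} (\<lambda>c. \<Sum>b<m. W k b * x b c) (\<lambda>c. \<Sum>b<m. W k b * y b c))"
    by (rule wedge_sym_le_concurrence_contraction)
  show ?thesis
    by (rule that[OF U W order_trans[OF concurrence_product_le_wedge_sym add_mono[OF U_le W_le]]])
qed

lemma concurrence_power2:
  "(concurrence J x y)\<^sup>2
    = 4 * ((\<Sum>i\<in>J. (cmod (x i))\<^sup>2) * (\<Sum>i\<in>J. (cmod (y i))\<^sup>2) - (cmod (\<Sum>i\<in>J. x i * cnj (y i)))\<^sup>2)"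
proof -
  have "complex_of_real ((concurrence J x y)\<^sup>2)
      = complex_of_real (2 * (\<Sum>i\<in>J. \<Sum>j\<in>J. (cmod (x i * y j - x j * y i))\<^sup>2))"
    by (simp add: concurrence_def power_mult_distrib l2norm_power2 sum.cartesian_product
        case_prod_unfold)
  also have "\<dots> = 2 * ((\<Sum>i\<in>J. \<Sum>j\<in>J. (x i * cnj (x i)) * (y j * cnj (y j)))
        + (\<Sum>i\<in>J. \<Sum>j\<in>J. (y i * cnj (y i)) * (x j * cnj (x j)))
        - (\<Sum>i\<in>J. \<Sum>j\<in>J. (x i * cnj (y i)) * (cnj (x j) * y j))
        - (\<Sum>i\<in>J. \<Sum>j\<in>J. (cnj (x i) * y i) * (x j * cnj (y j))))"
    unfolding of_real_mult of_real_sum complex_norm_square of_real_numeral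
      sum.distrib[symmetric] sum_subtractf[symmetric]
    by (intro arg_cong[of _ _ "(*) 2"] sum.cong refl) (simp add: algebra_simps)
  also have "\<dots> = 4 * ((\<Sum>i\<in>J. x i * cnj (x i)) * (\<Sum>i\<in>J. y i * cnj (y i))
       - (\<Sum>i\<in>J. x i * cnj (y i)) * cnj (\<Sum>i\<in>J. x i * cnj (y i)))"
    unfolding sum_product[symmetric] by (simp add: algebra_simps)
  also have "\<dots> = complex_of_real (4 * ((\<Sum>i\<in>J. (cmod (x i))\<^sup>2) * (\<Sum>i\<in>J. (cmod (y i))\<^sup>2)
      - (cmod (\<Sum>i\<in>J. x i * cnj (y i)))\<^sup>2))"
    by (simp only: of_real_mult of_real_diff of_real_sum_cmod_square complex_norm_square
        of_real_numeral)
  finally show ?thesis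
    by (simp only: of_real_eq_iff)
qed

lemma concurrence_le_norms: "concurrence J x y \<le> (\<Sum>i\<in>J. (cmod (x i))\<^sup>2) + (\<Sum>i\<in>J. (cmod (y i))\<^sup>2)"
proof (rule power2_le_imp_le)
  let ?a = "\<Sum>i\<in>J. (cmod (x i))\<^sup>2" and ?b = "\<Sum>i\<in>J. (cmod (y i))\<^sup>2"
  have "(concurrence J x y)\<^sup>2 \<le> 4 * (?a * ?b)"
    unfolding concurrence_power2 by simp
  also have "\<dots> = (?a + ?b)\<^sup>2 - (?a - ?b)\<^sup>2"
    by (simp add: power2_eq_square algebra_simps)
  also have "\<dots> \<le> (?a + ?b)\<^sup>2"
    using zero_le_power2[of "?a - ?b"] by linarith
  finally show "(concurrence J x y)\<^sup>2 \<le> (?a + ?b)\<^sup>2" .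
qed (simp add: sum_nonneg)

section \<open>Positive semidefinite kernels\<close>

definition psd_kernel :: "'i set \<Rightarrow> ('i \<Rightarrow> 'i \<Rightarrow> complex) \<Rightarrow> bool" where
  "psd_kernel I A \<longleftrightarrow> (\<forall>x. 0 \<le> (\<Sum>i\<in>I. \<Sum>j\<in>I. cnj (x i) * A i j * x j))"

lemma psd_kernelD: "psd_kernel I A \<Longrightarrow> 0 \<le> (\<Sum>i\<in>I. \<Sum>j\<in>I. cnj (x i) * A i j * x j)"
  by (simp add: psd_kernel_def)

lemma psd_kernel_subset:
  assumes "psd_kernel I A" "J \<subseteq> I" "finite I"
  shows "psd_kernel J A"
  unfolding psd_kernel_def
proof
  fix x
  define y where "y i = (if i \<in> J then x i else 0 :: complex)" for i
  have "(\<Sum>i\<in>J. \<Sum>j\<in>J. cnj (x i) * A i j * x j) = (\<Sum>i\<in>J. \<Sum>j\<in>I. cnj (y i) * A i j * y j)"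
    using assms by (intro sum.cong sum.mono_neutral_cong_left) (auto simp: y_def)
  also have "\<dots> = (\<Sum>i\<in>I. \<Sum>j\<in>I. cnj (y i) * A i j * y j)"
    using assms by (intro sum.mono_neutral_left) (auto simp: y_def)
  finally show "0 \<le> (\<Sum>i\<in>J. \<Sum>j\<in>J. cnj (x i) * A i j * x j)"
    using psd_kernelD[OF assms(1)] by simp
qed

lemma psd_kernel_diag:
  assumes "psd_kernel I A" "finite I" "k \<in> I"
  shows "0 \<le> A k k"
  using psd_kernelD[OF psd_kernel_subset[OF assms(1), of "{k}"], of "\<lambda>_. 1"] assms by simp

lemma psd_kernel_pair:
  assumes "psd_kernel I A" "finite I" "k \<in> I" "l \<in> I" "k \<noteq> l"
  shows "0 \<le> cnj a * A k k * a + cnj a * A k l * b + cnj b * A l k * a + cnj b * A l l * b"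
  using psd_kernelD[OF psd_kernel_subset[OF assms(1), of "{k, l}"],
      of "\<lambda>i. if i = k then a else b"] assms
  by (simp add: add_ac)

lemma psd_kernel_hermitian:
  assumes "psd_kernel I A" "finite I" "k \<in> I" "l \<in> I"
  shows "A l k = cnj (A k l)"
proof (cases "k = l")
  case True
  then show ?thesis
    using psd_kernel_diag[OF assms(1-3)] by (simp add: complex_eq_iff less_eq_complex_def)
next
  case False
  note pair = psd_kernel_pair[OF assms False]
  have "Im (A k k) = 0" "Im (A l l) = 0"
    using psd_kernel_diag[OF assms(1,2)] assms(3,4) by (auto simp: less_eq_complex_def)
  then show ?thesis
    using pair[of 1 1] pair[of 1 \<i>] by (simp add: complex_eq_iff less_eq_complex_def)
qed

lemma psd_kernel_zero_diag:
  assumes "psd_kernel I A" "finite I" "k \<in> I" "l \<in> I" "A k k = 0"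
  shows "A k l = 0"
proof (rule ccontr)
  assume nonzero: "A k l \<noteq> 0"
  then have "k \<noteq> l" using assms(5) by auto
  define s where "s = (Re (A l l) + 1) / (2 * (cmod (A k l))\<^sup>2)"
  have "0 \<le> Re (cnj (- of_real s * A k l) * A k l + A l k * (- of_real s * A k l) + A l l)"
    using psd_kernel_pair[OF assms(1-4) \<open>k \<noteq> l\<close>, of "- of_real s * A k l" 1] assms(5)
    by (simp add: less_eq_complex_def)
  also have "\<dots> = Re (A l l) - 2 * s * (cmod (A k l))\<^sup>2"
    unfolding psd_kernel_hermitian[OF assms(1-4)]
    by (simp add: cmod_power2) (simp add: power2_eq_square algebra_simps)
  finally show False
    using nonzero by (simp add: s_def)
qed

lemma psd_kernel_schur_complement:
  assumes "psd_kernel (insert k I) A" "finite I" "k \<notin> I"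
  shows "psd_kernel I (\<lambda>i j. A i j - A i k * A k j / A k k)"
  unfolding psd_kernel_def
proof
  fix x
  let ?q = "\<lambda>B. \<Sum>i\<in>I. \<Sum>j\<in>I. cnj (x i) * B i j * x j"
  define g where "g = (\<Sum>j\<in>I. A k j * x j)"
  have hermitian: "A i k = cnj (A k i)" if "i \<in> I" for i
    by (rule psd_kernel_hermitian[OF assms(1)]) (use that assms(2) in auto)
  have real_pivot: "cnj (A k k) = A k k"
    by (rule psd_kernel_hermitian[OF assms(1), symmetric]) (use assms(2) in auto)
  have cnj_g: "(\<Sum>i\<in>I. cnj (x i) * A i k) = cnj g"
    by (simp add: g_def hermitian mult.commute)
  define y where "y = x(k := - g / A k k)"
  have "0 \<le> (\<Sum>i\<in>insert k I. \<Sum>j\<in>insert k I. cnj (y i) * A i j * y j)"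
    using assms(1) by (rule psd_kernelD)
  also have "\<dots> = (\<Sum>i\<in>I. \<Sum>j\<in>I. cnj (y i) * A i j * y j) + (\<Sum>i\<in>I. cnj (y i) * A i k * y k)
      + (\<Sum>j\<in>I. cnj (y k) * A k j * y j) + cnj (y k) * A k k * y k"
    using assms(2,3) by (simp add: sum.distrib add_ac)
  also have "\<dots> = ?q A + (\<Sum>i\<in>I. cnj (x i) * A i k * y k) + (\<Sum>j\<in>I. cnj (y k) * A k j * x j)
      + cnj (y k) * A k k * y k"
    using assms(3) by (intro arg_cong2[of _ _ _ _ plus] sum.cong refl) (auto simp: y_def)
  also have "\<dots> = ?q A + cnj g * y k + cnj (y k) * g + cnj (y k) * A k k * y k"
    unfolding sum_distrib_right[symmetric] cnj_g by (simp add: g_def sum_distrib_left mult.assoc)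
  also have "\<dots> = ?q A - cnj g * g / A k k"
    by (cases "A k k = 0") (simp_all add: y_def real_pivot field_simps)
  also have "cnj g * g = ?q (\<lambda>i j. A i k * A k j)"
    unfolding cnj_g[symmetric] unfolding g_def sum_product by (simp only: mult_ac)
  also have "?q A - ?q (\<lambda>i j. A i k * A k j) / A k k = ?q (\<lambda>i j. A i j - A i k * A k j / A k k)"
    by (simp add: algebra_simps sum_subtractf sum_divide_distrib)
  finally show "0 \<le> ?q (\<lambda>i j. A i j - A i k * A k j / A k k)" .
qed

lemma psd_kernel_pivot:
  assumes "psd_kernel I A" "finite I" "k \<in> I" "i \<in> I" "j \<in> I" "i = k \<or> j = k"
  shows "A i k * A k j / A k k = A i j"
proof (cases "A k k = 0")
  case True
  have "A k i = 0" "A k j = 0"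
    using psd_kernel_zero_diag[OF assms(1-3) _ True] assms(4,5) by auto
  then have "A i k = 0" "A k j = 0"
    using psd_kernel_hermitian[OF assms(1,2) \<open>k \<in> I\<close> \<open>i \<in> I\<close>] by simp_all
  with assms(6) show ?thesis by auto
qed (use assms(6) in auto)

lemma psd_kernel_imp_gram:
  assumes "finite I" "psd_kernel I A"
  shows "\<exists>\<phi>. \<forall>i\<in>I. \<forall>j\<in>I. A i j = (\<Sum>m\<in>I. \<phi> m i * cnj (\<phi> m j))"
  using assms
proof (induction I arbitrary: A rule: finite_induct)
  case (insert k I)
  have finite_insert: "finite (insert k I)" using insert.hyps by simp
  obtain \<phi> where \<phi>: "A i j - A i k * A k j / A k k = (\<Sum>m\<in>I. \<phi> m i * cnj (\<phi> m j))"
    if "i \<in> I" "j \<in> I" for i j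
    using insert.IH[OF psd_kernel_schur_complement[OF insert.prems insert.hyps]] by blast
  define \<psi> where
    "\<psi> m i = (if m = k then A i k / sqrt (Re (A k k)) else if i = k then 0 else \<phi> m i)" for m i
  have pivot: "\<psi> k i * cnj (\<psi> k j) = A i k * A k j / A k k" if "j \<in> insert k I" for i j
  proof -
    have "0 \<le> A k k"
      using psd_kernel_diag[OF insert.prems finite_insert] by simp
    then have "complex_of_real (sqrt (Re (A k k))) * complex_of_real (sqrt (Re (A k k))) = A k k"
      by (simp add: complex_eq_iff less_eq_complex_def flip: of_real_mult)
    moreover have "A k j = cnj (A j k)"
      using psd_kernel_hermitian[OF insert.prems finite_insert that] by simp
    ultimately show ?thesis
      by (simp add: \<psi>_def)
  qed
  have "A i j = (\<Sum>m\<in>insert k I. \<psi> m i * cnj (\<psi> m j))"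
    if ij: "i \<in> insert k I" "j \<in> insert k I" for i j
  proof (cases "i = k \<or> j = k")
    case True
    then have "(\<Sum>m\<in>I. \<psi> m i * cnj (\<psi> m j)) = 0"
      using insert.hyps by (intro sum.neutral) (auto simp: \<psi>_def)
    then show ?thesis
      using insert.hyps psd_kernel_pivot[OF insert.prems finite_insert _ ij True]
      by (simp add: pivot[OF ij(2)])
  next
    case False
    have "(\<Sum>m\<in>I. \<psi> m i * cnj (\<psi> m j)) = (\<Sum>m\<in>I. \<phi> m i * cnj (\<phi> m j))"
      using False insert.hyps by (intro sum.cong) (auto simp: \<psi>_def)
    then show ?thesis
      using False ij insert.hyps \<phi>[of i j] by (simp add: pivot[OF ij(2)] diff_eq_eq add.commute)
  qed
  then show ?case by blast
qed simp

definition decomposes :: "nat \<Rightarrow> complex mat \<Rightarrow> 'k set \<Rightarrow> ('k \<Rightarrow> nat \<Rightarrow> complex) \<Rightarrow> bool" where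
  "decomposes D M K \<phi> \<longleftrightarrow> (\<forall>i<D. \<forall>j<D. M $$ (i, j) = (\<Sum>k\<in>K. \<phi> k i * cnj (\<phi> k j)))"

lemma decomposesD: "decomposes D M K \<phi> \<Longrightarrow> i < D \<Longrightarrow> j < D \<Longrightarrow> M $$ (i, j) = (\<Sum>k\<in>K. \<phi> k i * cnj (\<phi> k j))"
  by (simp add: decomposes_def)

lemma decomposes_reindex:
  assumes "bij_betw h J K"
  shows "decomposes D M J (\<lambda>k. \<phi> (h k)) \<longleftrightarrow> decomposes D M K \<phi>"
  using sum.reindex_bij_betw[OF assms, of "\<lambda>k. \<phi> k i * cnj (\<phi> k j)" for i j]
  by (simp add: decomposes_def)

lemma decomposes_mtrace:
  assumes "M \<in> carrier_mat D D" "decomposes D M K \<phi>"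
  shows "mtrace M = complex_of_real (\<Sum>k\<in>K. \<Sum>i<D. (cmod (\<phi> k i))\<^sup>2)"
proof -
  have "mtrace M = (\<Sum>i<D. \<Sum>k\<in>K. \<phi> k i * cnj (\<phi> k i))"
    using assms(1) by (simp add: mtrace_def decomposesD[OF assms(2)])
  also have "\<dots> = (\<Sum>k\<in>K. \<Sum>i<D. \<phi> k i * cnj (\<phi> k i))"
    by (rule sum.swap)
  finally show ?thesis
    by (simp only: of_real_sum complex_norm_square)
qed

lemma psd_imp_decomposes:
  assumes "psd D M"
  obtains \<phi> where "decomposes D M {..<D} \<phi>"
proof -
  have "psd_kernel {..<D} (\<lambda>i j. M $$ (i, j))"
    unfolding psd_kernel_def
  proof
    fix x
    have "quad_form D M (vec D x) = (\<Sum>i<D. \<Sum>j<D. cnj (x i) * M $$ (i, j) * x j)"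
      by (simp add: quad_form_def)
    then show "0 \<le> (\<Sum>i<D. \<Sum>j<D. cnj (x i) * M $$ (i, j) * x j)"
      using assms by (auto simp: psd_def less_eq_complex_def dest: bspec[of _ _ "vec D x"])
  qed
  then show ?thesis
    using that psd_kernel_imp_gram[of "{..<D}"] by (fastforce simp: decomposes_def)
qed

lemma decomposes_imp_psd:
  assumes "M \<in> carrier_mat D D" "decomposes D M K \<phi>"
  shows "psd D M"
proof -
  have "quad_form D M v = complex_of_real (\<Sum>k\<in>K. (cmod (\<Sum>j<D. cnj (\<phi> k j) * v $ j))\<^sup>2)" for v
  proof -
    have "quad_form D M v = (\<Sum>i<D. \<Sum>j<D. \<Sum>k\<in>K. (cnj (v $ i) * \<phi> k i) * (cnj (\<phi> k j) * v $ j))"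
      using decomposesD[OF assms(2)]
      by (simp add: quad_form_def sum_distrib_left sum_distrib_right mult_ac)
    also have "\<dots> = (\<Sum>k\<in>K. \<Sum>i<D. \<Sum>j<D. (cnj (v $ i) * \<phi> k i) * (cnj (\<phi> k j) * v $ j))"
      by (rule trans[OF sum.cong[OF refl sum.swap] sum.swap])
    also have "\<dots> = (\<Sum>k\<in>K. (\<Sum>j<D. cnj (\<phi> k j) * v $ j) * cnj (\<Sum>j<D. cnj (\<phi> k j) * v $ j))"
      unfolding sum_product[symmetric] by (simp add: mult_ac)
    finally show ?thesis
      by (simp only: of_real_sum_cmod_square)
  qed
  then show ?thesis
    using assms(1) by (simp add: psd_def sum_nonneg)
qed

lemma psd_mtrace_nonneg:
  assumes "psd D M"
  shows "0 \<le> mtrace M"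
proof -
  have carrier: "M \<in> carrier_mat D D" using assms by (simp add: psd_def)
  obtain \<phi> where "decomposes D M {..<D} \<phi>" using psd_imp_decomposes[OF assms] .
  from decomposes_mtrace[OF carrier this] show ?thesis
    by (simp only: less_eq_complex_def Re_complex_of_real Im_complex_of_real) (simp add: sum_nonneg)
qed

section \<open>Square roots of positive semidefinite 2x2 matrices\<close>

lemma sum_less_two: "(\<Sum>i<(2::nat). f i) = f 0 + (f 1 :: 'a :: comm_monoid_add)"
  by (simp add: numeral_2_eq_2)

lemma mat_two_eqI:
  assumes "A \<in> carrier_mat 2 2" "B \<in> carrier_mat 2 2" "\<And>i j. i < 2 \<Longrightarrow> j < 2 \<Longrightarrow> A $$ (i, j) = B $$ (i, j)"
  shows "A = B"
  using assms by (intro eq_matI) auto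

lemma mult_two_index:
  assumes "A \<in> carrier_mat 2 2" "B \<in> carrier_mat 2 2" "i < 2" "j < 2"
  shows "(A * B) $$ (i, j) = A $$ (i, 0) * B $$ (0, j) + A $$ (i, 1) * B $$ (1, j)"
  using assms by (simp add: scalar_prod_def numeral_2_eq_2)

lemma det_two:
  assumes "A \<in> carrier_mat 2 2"
  shows "det A = A $$ (0, 0) * A $$ (1, 1) - A $$ (0, 1) * A $$ (1, 0)"
proof -
  have "det (mat_delete A 0 0) = A $$ (1, 1)" "det (mat_delete A 0 1) = A $$ (1, 0)"
    using assms by (subst det_single; simp add: mat_delete_def)+
  then show ?thesis
    using laplace_expansion_row[OF assms, of 0] by (simp add: sum_less_two cofactor_def)
qed

lemma mtrace_two: "A \<in> carrier_mat 2 2 \<Longrightarrow> mtrace A = A $$ (0, 0) + A $$ (1, 1)"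
  by (simp add: mtrace_def sum_less_two)

lemma cayley_hamilton_two:
  assumes "A \<in> carrier_mat 2 2" "i < 2" "j < 2"
  shows "(A * A) $$ (i, j) = mtrace A * A $$ (i, j) - det A * of_bool (i = j)"
  unfolding mult_two_index[OF assms(1,1,2,3)] mtrace_two[OF assms(1)] det_two[OF assms(1)]
  using assms(2,3) by (auto simp: less_2_cases_iff algebra_simps)

lemma det_decomposes_two:
  assumes "A \<in> carrier_mat 2 2" "decomposes 2 A K \<phi>"
  shows "det A = complex_of_real ((concurrence K (\<lambda>k. \<phi> k 0) (\<lambda>k. \<phi> k 1))\<^sup>2 / 4)"
proof -
  let ?x = "\<lambda>k. \<phi> k 0" and ?y = "\<lambda>k. \<phi> k 1"
  have "det A = (\<Sum>k\<in>K. ?x k * cnj (?x k)) * (\<Sum>k\<in>K. ?y k * cnj (?y k))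
      - (\<Sum>k\<in>K. ?x k * cnj (?y k)) * cnj (\<Sum>k\<in>K. ?x k * cnj (?y k))"
    by (simp add: det_two[OF assms(1)] decomposesD[OF assms(2)] mult.commute)
  also have "\<dots> = complex_of_real ((\<Sum>k\<in>K. (cmod (?x k))\<^sup>2) * (\<Sum>k\<in>K. (cmod (?y k))\<^sup>2)
      - (cmod (\<Sum>k\<in>K. ?x k * cnj (?y k)))\<^sup>2)"
    by (simp only: of_real_diff of_real_mult of_real_sum_cmod_square complex_norm_square)
  finally show ?thesis
    by (simp add: concurrence_power2)
qed

lemma psd_two_det_nonneg:
  assumes "psd 2 A"
  shows "0 \<le> det A"
proof -
  have carrier: "A \<in> carrier_mat 2 2" using assms by (simp add: psd_def)
  obtain \<phi> where "decomposes 2 A {..<2 :: nat} \<phi>" using psd_imp_decomposes[OF assms] .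
  from det_decomposes_two[OF carrier this] show ?thesis
    by (simp only: less_eq_complex_def Re_complex_of_real Im_complex_of_real) simp
qed

lemma psd_two_square:
  assumes "psd 2 B"
  shows "(Re (mtrace B))\<^sup>2 = Re (mtrace (B * B)) + 2 * sqrt (Re (det (B * B)))"
    and "\<And>i j. i < 2 \<Longrightarrow> j < 2 \<Longrightarrow>
      Re (mtrace B) * B $$ (i, j) = (B * B) $$ (i, j) + sqrt (Re (det (B * B))) * of_bool (i = j)"
proof -
  have carrier: "B \<in> carrier_mat 2 2" using assms by (simp add: psd_def)
  define \<tau> \<delta> where "\<tau> = Re (mtrace B)" and "\<delta> = Re (det B)"
  have \<tau>: "mtrace B = complex_of_real \<tau>" and \<delta>: "det B = complex_of_real \<delta>" "0 \<le> \<delta>"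
    using psd_mtrace_nonneg[OF assms] psd_two_det_nonneg[OF assms]
    by (simp_all add: \<tau>_def \<delta>_def less_eq_complex_def complex_eq_iff)
  have "sqrt (Re (det (B * B))) = \<delta>"
    using \<delta> by (simp add: det_mult[OF carrier carrier])
  moreover have entry: "(B * B) $$ (i, j) = \<tau> * B $$ (i, j) - \<delta> * of_bool (i = j)"
    if "i < 2" "j < 2" for i j
    using cayley_hamilton_two[OF carrier that] by (simp add: \<tau> \<delta>)
  moreover have "mtrace (B * B) = \<tau> * mtrace B - 2 * \<delta>"
    unfolding mtrace_two[OF carrier] mtrace_two[OF mult_carrier_mat[OF carrier carrier]]
    using entry[of 0 0] entry[of 1 1] by (simp add: distrib_left del: index_mult_mat)
  ultimately show "(Re (mtrace B))\<^sup>2 = Re (mtrace (B * B)) + 2 * sqrt (Re (det (B * B)))"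
    "\<And>i j. i < 2 \<Longrightarrow> j < 2 \<Longrightarrow>
      Re (mtrace B) * B $$ (i, j) = (B * B) $$ (i, j) + sqrt (Re (det (B * B))) * of_bool (i = j)"
    by (simp_all add: \<tau> power2_eq_square)
qed

lemma psd_smult_add_one:
  assumes "psd d A" "0 \<le> a" "0 \<le> \<delta>"
  shows "psd d (complex_of_real a \<cdot>\<^sub>m (A + complex_of_real \<delta> \<cdot>\<^sub>m 1\<^sub>m d))" (is "psd d ?B")
proof -
  have A: "A \<in> carrier_mat d d" using assms(1) by (simp add: psd_def)
  have "quad_form d ?B v = of_real a * (quad_form d A v + of_real (\<delta> * (\<Sum>i<d. (cmod (v $ i))\<^sup>2)))"
    for v
  proof -
    have "quad_form d ?B v = (\<Sum>i<d. \<Sum>j<d. of_real a * (cnj (v $ i) * A $$ (i, j) * v $ j)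
        + (if i = j then of_real (a * \<delta>) * (v $ i * cnj (v $ i)) else 0))"
      unfolding quad_form_def using A by (intro sum.cong refl) (auto simp: algebra_simps)
    then show ?thesis
      unfolding of_real_mult of_real_sum_cmod_square quad_form_def
      by (simp add: sum.distrib distrib_left sum_distrib_left mult_ac)
  qed
  then show ?thesis
    using assms A by (simp add: psd_def sum_nonneg)
qed

lemma psd_two_root_exists:
  assumes "psd 2 A" "mtrace A \<noteq> 0"
  obtains B where "psd 2 B" "B * B = A"
proof -
  have carrier: "A \<in> carrier_mat 2 2" using assms by (simp add: psd_def)
  define \<tau> where "\<tau> = Re (mtrace A)"
  define \<delta> where "\<delta> = sqrt (Re (det A))"
  define t where "t = sqrt (\<tau> + 2 * \<delta>)"
  have \<tau>: "mtrace A = complex_of_real \<tau>" "0 < \<tau>"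
    using psd_mtrace_nonneg[OF assms(1)] assms(2)
    by (auto simp: \<tau>_def less_eq_complex_def complex_eq_iff)
  have \<delta>: "det A = complex_of_real (\<delta> * \<delta>)" "0 \<le> \<delta>"
    using psd_two_det_nonneg[OF assms(1)] by (simp_all add: \<delta>_def less_eq_complex_def complex_eq_iff)
  have t: "0 < t" "t * t = \<tau> + 2 * \<delta>" using \<tau>(2) \<delta>(2) by (simp_all add: t_def)
  define B where "B = complex_of_real (1 / t) \<cdot>\<^sub>m (A + complex_of_real \<delta> \<cdot>\<^sub>m 1\<^sub>m 2)"
  have B_carrier: "B \<in> carrier_mat 2 2" using carrier by (simp add: B_def)
  have entry: "B $$ (i, j) = (A $$ (i, j) + \<delta> * of_bool (i = j)) / t" if "i < 2" "j < 2" for i j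
    using that carrier by (simp add: B_def)
  have "B * B = A"
  proof (rule mat_two_eqI[OF _ carrier])
    show "B * B \<in> carrier_mat 2 2" using B_carrier by simp
    fix i j :: nat assume ij: "i < 2" "j < 2"
    have "(B * B) $$ (i, j)
        = ((A * A) $$ (i, j) + 2 * \<delta> * A $$ (i, j) + \<delta> * \<delta> * of_bool (i = j)) / (t * t)"
      using t(1) ij
      by (auto simp: mult_two_index[OF B_carrier B_carrier] mult_two_index[OF carrier carrier] entry
          field_simps less_2_cases_iff)
    also have "\<dots> = (t * t) * A $$ (i, j) / (t * t)"
      unfolding cayley_hamilton_two[OF carrier ij] \<tau>(1) \<delta>(1) of_real_mult[symmetric] t(2)
      by (simp add: algebra_simps)
    finally show "(B * B) $$ (i, j) = A $$ (i, j)"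
      using t(1) by simp
  qed
  moreover have "psd 2 B"
    unfolding B_def using assms(1) t \<delta> by (intro psd_smult_add_one) auto
  ultimately show ?thesis using that by blast
qed

lemma psd_two_root_unique:
  assumes A: "psd 2 A" "mtrace A \<noteq> 0" and B: "psd 2 B" "B * B = A" and C: "psd 2 C" "C * C = A"
  shows "B = C"
proof (rule mat_two_eqI)
  show "B \<in> carrier_mat 2 2" "C \<in> carrier_mat 2 2"
    using B C by (simp_all add: psd_def)
  have "0 < Re (mtrace A)" "0 \<le> Re (det A)"
    using psd_mtrace_nonneg[OF A(1)] psd_two_det_nonneg[OF A(1)] A(2)
    by (auto simp: less_eq_complex_def complex_eq_iff)
  then have "0 < (Re (mtrace B))\<^sup>2"
    unfolding psd_two_square(1)[OF B(1)] B(2) by (simp add: add_pos_nonneg)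
  moreover have "Re (mtrace B) = Re (mtrace C)"
  proof (rule power2_eq_imp_eq)
    show "(Re (mtrace B))\<^sup>2 = (Re (mtrace C))\<^sup>2"
      unfolding psd_two_square(1)[OF B(1)] psd_two_square(1)[OF C(1)] B(2) C(2) ..
  qed (use psd_mtrace_nonneg[OF B(1)] psd_mtrace_nonneg[OF C(1)] in \<open>simp_all add: less_eq_complex_def\<close>)
  moreover have "Re (mtrace B) * B $$ (i, j) = Re (mtrace C) * C $$ (i, j)"
    if "i < 2" "j < 2" for i j
    unfolding psd_two_square(2)[OF B(1) that] psd_two_square(2)[OF C(1) that] B(2) C(2) ..
  ultimately show "B $$ (i, j) = C $$ (i, j)" if "i < 2" "j < 2" for i j
    using that by simp
qed

lemma mtrace_mat_sqrt_two:
  assumes "psd 2 A" "mtrace A \<noteq> 0"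
  shows "(Re (mtrace (mat_sqrt 2 A)))\<^sup>2 = Re (mtrace A) + 2 * sqrt (Re (det A))"
proof -
  obtain B where B: "psd 2 B" "B * B = A"
    using psd_two_root_exists[OF assms] .
  then have "mat_sqrt 2 A = B"
    unfolding mat_sqrt_def using psd_two_root_unique[OF assms] by (intro the_equality) auto
  then show ?thesis
    using psd_two_square(1)[OF B(1)] B(2) by simp
qed

section \<open>The negativity of a pure state with a qubit\<close>

text \<open>Homogeneous of degree 2, so that the probabilities of an ensemble can be absorbed into its
  vectors.\<close>

definition qubit_concurrence :: "nat \<Rightarrow> (nat \<Rightarrow> complex) \<Rightarrow> real" where
  "qubit_concurrence d f = concurrence {..<d} f (\<lambda>i. f (d + i))"

lemma qubit_concurrence_nonneg: "0 \<le> qubit_concurrence d f"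
  by (simp add: qubit_concurrence_def concurrence_nonneg)

lemma qubit_concurrence_cong:
  assumes "\<And>i. i < 2 * d \<Longrightarrow> f i = g i"
  shows "qubit_concurrence d f = qubit_concurrence d g"
  unfolding qubit_concurrence_def using assms by (intro concurrence_cong) auto

lemma qubit_concurrence_scale: "qubit_concurrence d (\<lambda>i. a * f i) = (cmod a)\<^sup>2 * qubit_concurrence d f"
  by (simp add: qubit_concurrence_def concurrence_scale)

lemma sum_lessThan_add:
  fixes g :: "nat \<Rightarrow> 'a :: comm_monoid_add"
  shows "(\<Sum>i<m + n. g i) = (\<Sum>i<m. g i) + (\<Sum>i<n. g (m + i))"
  by (induction n) (simp_all add: add_ac)

lemma qubit_concurrence_le: "qubit_concurrence d f \<le> (\<Sum>i<2 * d. (cmod (f i))\<^sup>2)"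
  using concurrence_le_norms[of "{..<d}" f "\<lambda>i. f (d + i)"]
  by (simp add: qubit_concurrence_def mult_2 sum_lessThan_add)

lemma negativity_pure_eq_concurrence:
  assumes "unit_vec (2 * d) \<psi>"
  shows "negativity_pure 2 d \<psi> = qubit_concurrence d (\<lambda>i. \<psi> $ i)"
proof -
  define R where "R = ptrace_2 2 d (proj \<psi>)"
  have dim: "dim_vec \<psi> = 2 * d" and norm: "(\<Sum>i<2 * d. (cmod (\<psi> $ i))\<^sup>2) = 1"
    using assms by (simp_all add: unit_vec_def)
  have R_carrier: "R \<in> carrier_mat 2 2"
    by (simp add: R_def ptrace_2_def)
  have decomposition: "decomposes 2 R {..<d} (\<lambda>k a. \<psi> $ (a * d + k))"
  proof -
    have "a * d + k < 2 * d" if "a < 2" "k < d" for a k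
      using that by (auto simp: less_2_cases_iff)
    then show ?thesis
      using dim by (simp add: decomposes_def R_def ptrace_2_def proj_def)
  qed
  have "mtrace R = complex_of_real (\<Sum>i<2 * d. (cmod (\<psi> $ i))\<^sup>2)"
    unfolding decomposes_mtrace[OF R_carrier decomposition]
    by (simp add: sum_less_two mult_2 sum_lessThan_add sum.distrib)
  then have "mtrace R = 1"
    by (simp only: norm of_real_1)
  then have "negativity_pure 2 d \<psi> = 2 * sqrt (Re (det R))"
    using mtrace_mat_sqrt_two[OF decomposes_imp_psd[OF R_carrier decomposition]]
    by (simp add: negativity_pure_def R_def)
  also have "det R = complex_of_real ((qubit_concurrence d (\<lambda>i. \<psi> $ i))\<^sup>2 / 4)"
    using det_decomposes_two[OF R_carrier decomposition] by (simp add: qubit_concurrence_def)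
  finally show ?thesis
    by (simp add: real_sqrt_divide qubit_concurrence_nonneg)
qed

section \<open>Ensembles as decompositions into outer products\<close>

lemma sum_list_pair_nth: "(\<Sum>(p, \<psi>)\<leftarrow>E. g p \<psi>) = (\<Sum>k<length E. g (fst (E ! k)) (snd (E ! k)))"
  by (simp add: sum_list_sum_nth atLeast0LessThan case_prod_unfold)

definition scaled_vec :: "real \<times> complex vec \<Rightarrow> nat \<Rightarrow> complex" where
  "scaled_vec = (\<lambda>(p, \<psi>) i. complex_of_real (sqrt p) * \<psi> $ i)"

lemma pure_ensemble_iff_decomposes:
  assumes "M \<in> carrier_mat D D"
  shows "pure_ensemble D M E \<longleftrightarrow>
    (\<forall>(p, \<psi>)\<in>set E. 0 \<le> p \<and> unit_vec D \<psi>) \<and> decomposes D M {..<length E} (\<lambda>k. scaled_vec (E ! k))"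
proof -
  let ?S = "\<lambda>i j. \<Sum>(p, \<psi>)\<leftarrow>E. complex_of_real p * \<psi> $ i * cnj (\<psi> $ j)"
  have "M = mat D D (\<lambda>(i, j). ?S i j) \<longleftrightarrow> decomposes D M {..<length E} (\<lambda>k. scaled_vec (E ! k))"
    if nonneg: "\<forall>(p, \<psi>)\<in>set E. 0 \<le> p \<and> unit_vec D \<psi>"
  proof -
    have "complex_of_real (fst (E ! k)) * snd (E ! k) $ i * cnj (snd (E ! k) $ j)
        = scaled_vec (E ! k) i * cnj (scaled_vec (E ! k) j)" if "k < length E" for k i j
    proof -
      have "0 \<le> fst (E ! k)"
        using nonneg nth_mem[OF that] by (auto simp: case_prod_unfold)
      then have "complex_of_real (fst (E ! k))
          = complex_of_real (sqrt (fst (E ! k))) * complex_of_real (sqrt (fst (E ! k)))"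
        by (simp flip: of_real_mult)
      then show ?thesis
        by (simp add: scaled_vec_def case_prod_unfold)
    qed
    then have "?S i j = (\<Sum>k<length E. scaled_vec (E ! k) i * cnj (scaled_vec (E ! k) j))" for i j
      unfolding sum_list_pair_nth by (intro sum.cong) auto
    then show ?thesis
      using assms by (auto simp: decomposes_def)
  qed
  then show ?thesis
    unfolding pure_ensemble_def by blast
qed

lemma pure_ensemble_sum_negativity:
  assumes "\<forall>(p, \<psi>)\<in>set E. 0 \<le> p \<and> unit_vec (2 * d) \<psi>"
  shows "(\<Sum>(p, \<psi>)\<leftarrow>E. p * negativity_pure 2 d \<psi>)
    = (\<Sum>k<length E. qubit_concurrence d (scaled_vec (E ! k)))"
  unfolding sum_list_pair_nth
proof (intro sum.cong refl)
  fix k assume "k \<in> {..<length E}"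
  then have "0 \<le> fst (E ! k)" "unit_vec (2 * d) (snd (E ! k))"
    using assms nth_mem[of k E] by (auto simp: case_prod_unfold)
  then show "fst (E ! k) * negativity_pure 2 d (snd (E ! k)) = qubit_concurrence d (scaled_vec (E ! k))"
    by (simp add: scaled_vec_def case_prod_unfold qubit_concurrence_scale
        negativity_pure_eq_concurrence)
qed

lemma scaled_unit_vec_exists:
  fixes f :: "nat \<Rightarrow> complex"
  assumes "0 < D"
  obtains p \<psi> where "0 \<le> p" "unit_vec D \<psi>" "\<And>i. i < D \<Longrightarrow> scaled_vec (p, \<psi>) i = f i"
proof (cases "(\<Sum>i<D. (cmod (f i))\<^sup>2) = 0")
  case True
  show ?thesis
  proof (rule that[of 0 "vec D (\<lambda>i. of_bool (i = 0))"])
    show "unit_vec D (vec D (\<lambda>i. of_bool (i = 0)))"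
      using assms by (simp add: unit_vec_def of_bool_def if_distrib[of "\<lambda>z. (cmod z)\<^sup>2"] cong: if_cong)
    show "scaled_vec (0, vec D (\<lambda>i. of_bool (i = 0))) i = f i" if "i < D" for i
      using True that by (simp add: scaled_vec_def sum_nonneg_eq_0_iff)
  qed simp
next
  case False
  define p where "p = (\<Sum>i<D. (cmod (f i))\<^sup>2)"
  have "0 < p" using False by (simp add: p_def less_le sum_nonneg)
  show ?thesis
  proof (rule that[of p "vec D (\<lambda>i. f i / complex_of_real (sqrt p))"])
    have "(\<Sum>i<D. (cmod (f i / complex_of_real (sqrt p)))\<^sup>2) = p / p"
      unfolding p_def sum_divide_distrib[of _ _ "sum _ _"] using \<open>0 < p\<close>
      by (simp add: norm_divide power_divide p_def[symmetric])
    then show "unit_vec D (vec D (\<lambda>i. f i / complex_of_real (sqrt p)))"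
      using \<open>0 < p\<close> by (simp add: unit_vec_def)
  qed (use \<open>0 < p\<close> in \<open>simp_all add: scaled_vec_def\<close>)
qed

lemma decomposes_imp_pure_ensemble:
  assumes "0 < D" "M \<in> carrier_mat D D" "decomposes D M {..<n} \<phi>"
  obtains E where "pure_ensemble D M E" "length E = n"
    "\<And>k i. k < n \<Longrightarrow> i < D \<Longrightarrow> scaled_vec (E ! k) i = \<phi> k i"
proof -
  have "\<exists>e. 0 \<le> fst e \<and> unit_vec D (snd e) \<and> (\<forall>i<D. scaled_vec e i = \<phi> k i)" for k
    by (rule scaled_unit_vec_exists[OF assms(1), of "\<phi> k"]) (metis fst_conv snd_conv)
  then obtain e where e: "\<And>k. 0 \<le> fst (e k)" "\<And>k. unit_vec D (snd (e k))"
    and scaled: "\<And>k i. i < D \<Longrightarrow> scaled_vec (e k) i = \<phi> k i"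
    by metis
  have "decomposes D M {..<n} (\<lambda>k. scaled_vec (e k))"
    using assms(3) by (simp add: decomposes_def scaled)
  then have "pure_ensemble D M (map e [0..<n])"
    using e by (auto simp: pure_ensemble_iff_decomposes[OF assms(2)] case_prod_unfold decomposes_def)
  then show ?thesis
    using scaled by (intro that[of "map e [0..<n]"]) auto
qed

definition concurrence_averages :: "nat \<Rightarrow> complex mat \<Rightarrow> real set" where
  "concurrence_averages d M
    = {\<Sum>k<n. qubit_concurrence d (\<phi> k) | (n :: nat) \<phi>. decomposes (2 * d) M {..<n} \<phi>}"

lemma concurrence_averagesI:
  fixes n :: nat
  assumes "decomposes (2 * d) M {..<n} \<phi>"
  shows "(\<Sum>k<n. qubit_concurrence d (\<phi> k)) \<in> concurrence_averages d M"
  using assms unfolding concurrence_averages_def by blast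

lemma negativity_assist_eq_Sup:
  assumes "0 < d" "M \<in> carrier_mat (2 * d) (2 * d)"
  shows "negativity_assist 2 d M = Sup (concurrence_averages d M)"
  unfolding negativity_assist_def
proof (rule arg_cong[of _ _ Sup], intro equalityI subsetI)
  fix z assume "z \<in> {\<Sum>(p, \<psi>)\<leftarrow>E. p * negativity_pure 2 d \<psi> |E. pure_ensemble (2 * d) M E}"
  then obtain E where "pure_ensemble (2 * d) M E" and z: "z = (\<Sum>(p, \<psi>)\<leftarrow>E. p * negativity_pure 2 d \<psi>)"
    by blast
  then have decomposition: "decomposes (2 * d) M {..<length E} (\<lambda>k. scaled_vec (E ! k))"
    and unit: "\<forall>(p, \<psi>)\<in>set E. 0 \<le> p \<and> unit_vec (2 * d) \<psi>"
    by (simp_all add: pure_ensemble_iff_decomposes[OF assms(2)])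
  then show "z \<in> concurrence_averages d M"
    unfolding z pure_ensemble_sum_negativity[OF unit] by (intro concurrence_averagesI decomposition)
next
  fix z assume "z \<in> concurrence_averages d M"
  then obtain n :: nat and \<phi> where "decomposes (2 * d) M {..<n} \<phi>"
    and z: "z = (\<Sum>k<n. qubit_concurrence d (\<phi> k))"
    unfolding concurrence_averages_def by blast
  then obtain E where E: "pure_ensemble (2 * d) M E" "length E = n"
    and scaled: "\<And>k i. k < n \<Longrightarrow> i < 2 * d \<Longrightarrow> scaled_vec (E ! k) i = \<phi> k i"
    using decomposes_imp_pure_ensemble[of "2 * d" M n \<phi>] assms by auto
  have "(\<Sum>(p, \<psi>)\<leftarrow>E. p * negativity_pure 2 d \<psi>) = (\<Sum>k<n. qubit_concurrence d (scaled_vec (E ! k)))"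
    using pure_ensemble_sum_negativity[of E d] E
    by (simp add: pure_ensemble_iff_decomposes[OF assms(2)])
  also have "\<dots> = z"
    unfolding z using scaled by (intro sum.cong refl qubit_concurrence_cong) auto
  finally show "z \<in> {\<Sum>(p, \<psi>)\<leftarrow>E. p * negativity_pure 2 d \<psi> |E. pure_ensemble (2 * d) M E}"
    using E(1) by blast
qed

lemma decomposes_sum_concurrence_le_mtrace:
  assumes "M \<in> carrier_mat (2 * d) (2 * d)" "decomposes (2 * d) M K \<phi>"
  shows "(\<Sum>k\<in>K. qubit_concurrence d (\<phi> k)) \<le> Re (mtrace M)"
  unfolding decomposes_mtrace[OF assms] Re_complex_of_real by (intro sum_mono qubit_concurrence_le)

lemma negativity_assist_ge:
  assumes "0 < d" "M \<in> carrier_mat (2 * d) (2 * d)" "finite K" "decomposes (2 * d) M K \<phi>"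
  shows "(\<Sum>k\<in>K. qubit_concurrence d (\<phi> k)) \<le> negativity_assist 2 d M"
  unfolding negativity_assist_eq_Sup[OF assms(1,2)]
proof (rule cSup_upper)
  obtain h where bij: "bij_betw h {..<card K} K"
    using ex_bij_betw_nat_finite[OF assms(3)] by (auto simp: atLeast0LessThan)
  then have "decomposes (2 * d) M {..<card K} (\<lambda>k. \<phi> (h k))"
    using assms(4) by (simp add: decomposes_reindex)
  moreover have "(\<Sum>k\<in>K. qubit_concurrence d (\<phi> k)) = (\<Sum>k<card K. qubit_concurrence d (\<phi> (h k)))"
    by (rule sum.reindex_bij_betw[OF bij, symmetric])
  ultimately show "(\<Sum>k\<in>K. qubit_concurrence d (\<phi> k)) \<in> concurrence_averages d M"
    by (simp only: concurrence_averagesI)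
  show "bdd_above (concurrence_averages d M)"
    unfolding concurrence_averages_def
    using decomposes_sum_concurrence_le_mtrace[OF assms(2)]
    by (intro bdd_aboveI[of _ "Re (mtrace M)"]) blast
qed

lemma negativity_assist_le:
  assumes "0 < d" "psd (2 * d) M"
    and "\<And>(n :: nat) \<phi>. decomposes (2 * d) M {..<n} \<phi> \<Longrightarrow> (\<Sum>k<n. qubit_concurrence d (\<phi> k)) \<le> c"
  shows "negativity_assist 2 d M \<le> c"
proof -
  have "M \<in> carrier_mat (2 * d) (2 * d)" using assms(2) by (simp add: psd_def)
  moreover obtain \<phi> where "decomposes (2 * d) M {..<2 * d} \<phi>"
    using psd_imp_decomposes[OF assms(2)] .
  ultimately show ?thesis
    using assms(3) unfolding negativity_assist_eq_Sup[OF assms(1) \<open>M \<in> _\<close>] concurrence_averages_def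
    by (intro cSup_least) blast+
qed

lemma negativity_assist_nonneg:
  assumes "0 < d" "psd (2 * d) M"
  shows "0 \<le> negativity_assist 2 d M"
proof -
  obtain \<phi> where "decomposes (2 * d) M {..<2 * d} \<phi>"
    using psd_imp_decomposes[OF assms(2)] .
  then have "(\<Sum>k<2 * d. qubit_concurrence d (\<phi> k)) \<le> negativity_assist 2 d M"
    using assms by (intro negativity_assist_ge) (auto simp: psd_def)
  then show ?thesis
    using sum_nonneg[of "{..<2 * d}" "\<lambda>k. qubit_concurrence d (\<phi> k)"] qubit_concurrence_nonneg
    by (meson order_trans)
qed

section \<open>Polygamy of the negativity of assistance\<close>

definition contract_last :: "nat \<Rightarrow> (nat \<Rightarrow> complex) \<Rightarrow> (nat \<Rightarrow> complex) \<Rightarrow> nat \<Rightarrow> complex" where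
  "contract_last d3 u f i = (\<Sum>c<d3. u c * f (i * d3 + c))"

definition contract_middle :: "nat \<Rightarrow> nat \<Rightarrow> (nat \<Rightarrow> complex) \<Rightarrow> (nat \<Rightarrow> complex) \<Rightarrow> nat \<Rightarrow> complex" where
  "contract_middle d2 d3 u f i = (\<Sum>b<d2. u b * f ((i div d3) * (d2 * d3) + b * d3 + i mod d3))"

lemma mult_add_less_mult:
  fixes a b m n :: nat
  assumes "a < m" "b < n"
  shows "a * n + b < m * n"
proof -
  have "a * n + b < (a + 1) * n" using assms(2) by simp
  also have "\<dots> \<le> m * n" using assms(1) by (intro mult_right_mono) auto
  finally show ?thesis .
qed

lemma bij_betw_mult_add: "bij_betw (\<lambda>(b, c). b * n + c) ({..<m} \<times> {..<n}) {..<m * n :: nat}"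
proof (cases "n = 0")
  case False
  then show ?thesis
    by (intro bij_betwI[where g = "\<lambda>i. (i div n, i mod n)"])
      (auto simp: mult_add_less_mult less_mult_imp_div_less)
qed (simp add: bij_betw_def)

lemma decomposes_contraction:
  assumes \<phi>: "decomposes D \<rho> K \<phi>" and U: "\<And>k. isometry r d (U k)"
    and entry: "\<And>i j. i < D' \<Longrightarrow> j < D' \<Longrightarrow> M $$ (i, j) = (\<Sum>c<d. \<rho> $$ (h i c, h j c))"
    and index_less: "\<And>i c. i < D' \<Longrightarrow> c < d \<Longrightarrow> h i c < D"
  shows "decomposes D' M (K \<times> {..<r}) (\<lambda>(k, m) i. \<Sum>c<d. U k m c * \<phi> k (h i c))"
  unfolding decomposes_def
proof (intro allI impI)
  fix i j assume ij: "i < D'" "j < D'"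
  have "M $$ (i, j) = (\<Sum>c<d. \<Sum>k\<in>K. \<phi> k (h i c) * cnj (\<phi> k (h j c)))"
    using ij index_less by (simp add: entry decomposesD[OF \<phi>])
  also have "\<dots> = (\<Sum>k\<in>K. \<Sum>m<r. (\<Sum>c<d. U k m c * \<phi> k (h i c)) * cnj (\<Sum>c<d. U k m c * \<phi> k (h j c)))"
    unfolding isometry_inner[OF U] by (rule sum.swap)
  finally show "M $$ (i, j) = (\<Sum>p\<in>K \<times> {..<r}. (\<lambda>(k, m) i. \<Sum>c<d. U k m c * \<phi> k (h i c)) p i
      * cnj ((\<lambda>(k, m) i. \<Sum>c<d. U k m c * \<phi> k (h i c)) p j))"
    by (simp only: sum.cartesian_product case_prod_unfold)
qed

lemma decomposes_reduced_12:
  assumes "decomposes (d1 * (d2 * d3)) \<rho> K \<phi>" "\<And>k. isometry r d3 (U k)"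
  shows "decomposes (d1 * d2) (reduced_12 d1 d2 d3 \<rho>) (K \<times> {..<r})
    (\<lambda>(k, m). contract_last d3 (U k m) (\<phi> k))"
  unfolding contract_last_def
proof (rule decomposes_contraction[OF assms])
  show "i * d3 + c < d1 * (d2 * d3)" if "i < d1 * d2" "c < d3" for i c
    using mult_add_less_mult[OF that] by (simp add: mult.assoc)
qed (simp add: reduced_12_def ptrace_2_def)

lemma decomposes_reduced_13:
  assumes "decomposes (d1 * (d2 * d3)) \<rho> K \<phi>" "\<And>k. isometry r d2 (U k)"
  shows "decomposes (d1 * d3) (reduced_13 d1 d2 d3 \<rho>) (K \<times> {..<r})
    (\<lambda>(k, m). contract_middle d2 d3 (U k m) (\<phi> k))"
  unfolding contract_middle_def
proof (rule decomposes_contraction[OF assms])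
  show "(i div d3) * (d2 * d3) + b * d3 + i mod d3 < d1 * (d2 * d3)" if "i < d1 * d3" "b < d2" for i b
  proof -
    have "0 < d3" using that(1) by (cases d3) auto
    then have "b * d3 + i mod d3 < d2 * d3" "i div d3 < d1"
      using that by (simp_all add: mult_add_less_mult less_mult_imp_div_less)
    from mult_add_less_mult[OF this(2,1)] show ?thesis
      by (simp add: add.assoc)
  qed
qed (simp add: reduced_13_def)

lemma reduced_12_carrier: "reduced_12 d1 d2 d3 \<rho> \<in> carrier_mat (d1 * d2) (d1 * d2)"
  by (simp add: reduced_12_def ptrace_2_def)

lemma reduced_13_carrier: "reduced_13 d1 d2 d3 \<rho> \<in> carrier_mat (d1 * d3) (d1 * d3)"
  by (simp add: reduced_13_def)

lemma psd_reduced_12: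
  assumes "psd (d1 * (d2 * d3)) \<rho>"
  shows "psd (d1 * d2) (reduced_12 d1 d2 d3 \<rho>)"
  by (rule psd_imp_decomposes[OF assms])
    (rule decomposes_imp_psd[OF reduced_12_carrier decomposes_reduced_12[OF _ isometry_identity]])

lemma psd_reduced_13:
  assumes "psd (d1 * (d2 * d3)) \<rho>"
  shows "psd (d1 * d3) (reduced_13 d1 d2 d3 \<rho>)"
  by (rule psd_imp_decomposes[OF assms])
    (rule decomposes_imp_psd[OF reduced_13_carrier decomposes_reduced_13[OF _ isometry_identity]])

lemma qubit_concurrence_le_contractions:
  obtains U W where "isometry n n U" "isometry m m W"
    "qubit_concurrence (m * n) f \<le> (\<Sum>k<n. qubit_concurrence m (contract_last n (U k) f))
      + (\<Sum>k<m. qubit_concurrence n (contract_middle m n (W k) f))"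
proof -
  define x y where "x b c = f (b * n + c)" and "y b c = f (m * n + (b * n + c))" for b c
  obtain U W where UW: "isometry n n U" "isometry m m W" and tripartite_le:
    "concurrence ({..<m} \<times> {..<n}) (\<lambda>(b, c). x b c) (\<lambda>(b, c). y b c)
      \<le> (\<Sum>k<n. concurrence {..<m} (\<lambda>b. \<Sum>c<n. U k c * x b c) (\<lambda>b. \<Sum>c<n. U k c * y b c))
        + (\<Sum>k<m. concurrence {..<n} (\<lambda>c. \<Sum>b<m. W k b * x b c) (\<lambda>c. \<Sum>b<m. W k b * y b c))"
    by (rule concurrence_tripartite_le)
  have "concurrence ({..<m} \<times> {..<n}) (\<lambda>(b, c). x b c) (\<lambda>(b, c). y b c) = qubit_concurrence (m * n) f"
    using concurrence_reindex[OF bij_betw_mult_add, of m n f "\<lambda>i. f (m * n + i)"]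
    by (simp add: qubit_concurrence_def x_def y_def case_prod_unfold)
  moreover have "concurrence {..<m} (\<lambda>b. \<Sum>c<n. u c * x b c) (\<lambda>b. \<Sum>c<n. u c * y b c)
      = qubit_concurrence m (contract_last n u f)" for u
    unfolding qubit_concurrence_def
    by (rule concurrence_cong) (simp_all add: contract_last_def x_def y_def algebra_simps)
  moreover have "concurrence {..<n} (\<lambda>c. \<Sum>b<m. u b * x b c) (\<lambda>c. \<Sum>b<m. u b * y b c)
      = qubit_concurrence n (contract_middle m n u f)" for u
    unfolding qubit_concurrence_def
    by (rule concurrence_cong) (simp_all add: contract_middle_def x_def y_def add.assoc)
  ultimately show ?thesis
    using that[OF UW] tripartite_le by simp
qed

theorem negativity_assist_polygamy:
  assumes "0 < m" "0 < n" "psd (2 * (m * n)) \<rho>"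
  shows "negativity_assist 2 (m * n) \<rho>
    \<le> negativity_assist 2 m (reduced_12 2 m n \<rho>) + negativity_assist 2 n (reduced_13 2 m n \<rho>)"
proof (rule negativity_assist_le)
  fix N :: nat and \<phi> assume \<phi>: "decomposes (2 * (m * n)) \<rho> {..<N} \<phi>"
  have "\<exists>U W. isometry n n U \<and> isometry m m W \<and> qubit_concurrence (m * n) (\<phi> k)
      \<le> (\<Sum>l<n. qubit_concurrence m (contract_last n (U l) (\<phi> k)))
        + (\<Sum>l<m. qubit_concurrence n (contract_middle m n (W l) (\<phi> k)))" for k
    using qubit_concurrence_le_contractions[of n m "\<phi> k"] by blast
  then obtain U W where U: "\<And>k. isometry n n (U k)" and W: "\<And>k. isometry m m (W k)"
    and concurrence_le: "\<And>k. qubit_concurrence (m * n) (\<phi> k)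
      \<le> (\<Sum>l<n. qubit_concurrence m (contract_last n (U k l) (\<phi> k)))
        + (\<Sum>l<m. qubit_concurrence n (contract_middle m n (W k l) (\<phi> k)))"
    by metis
  have "(\<Sum>k<N. qubit_concurrence (m * n) (\<phi> k))
      \<le> (\<Sum>k<N. \<Sum>l<n. qubit_concurrence m (contract_last n (U k l) (\<phi> k)))
        + (\<Sum>k<N. \<Sum>l<m. qubit_concurrence n (contract_middle m n (W k l) (\<phi> k)))"
    unfolding sum.distrib[symmetric] by (intro sum_mono concurrence_le)
  also have "(\<Sum>k<N. \<Sum>l<n. qubit_concurrence m (contract_last n (U k l) (\<phi> k)))
      \<le> negativity_assist 2 m (reduced_12 2 m n \<rho>)"
    using negativity_assist_ge[OF \<open>0 < m\<close> reduced_12_carrier _ decomposes_reduced_12[OF \<phi> U]]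
    by (simp add: sum.cartesian_product case_prod_unfold)
  also have "(\<Sum>k<N. \<Sum>l<m. qubit_concurrence n (contract_middle m n (W k l) (\<phi> k)))
      \<le> negativity_assist 2 n (reduced_13 2 m n \<rho>)"
    using negativity_assist_ge[OF \<open>0 < n\<close> reduced_13_carrier _ decomposes_reduced_13[OF \<phi> W]]
    by (simp add: sum.cartesian_product case_prod_unfold)
  finally show "(\<Sum>k<N. qubit_concurrence (m * n) (\<phi> k))
      \<le> negativity_assist 2 m (reduced_12 2 m n \<rho>) + negativity_assist 2 n (reduced_13 2 m n \<rho>)"
    by simp
qed (use assms in auto)

theorem theorem4:
  fixes n :: nat and \<rho> :: "complex mat" and k q s \<beta> :: real
  assumes "n \<ge> 3"
    and "density (2 * 2 * 2 ^ (n - 2)) \<rho>"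
    and "k \<ge> 1" and "0 < q" and "q \<le> 1" and "0 < s" and "s \<le> 1" and "\<beta> \<ge> s"
  shows
   "(negativity_assist 2 (2 ^ (n - 2)) (reduced_13 2 2 (2 ^ (n - 2)) \<rho>) powr s
       \<ge> k * negativity_assist 2 2 (reduced_12 2 2 (2 ^ (n - 2)) \<rho>) powr s \<longrightarrow>
     negativity_assist 2 (2 * 2 ^ (n - 2)) \<rho> powr \<beta>
       \<le> q powr (\<beta> / s) * negativity_assist 2 2 (reduced_12 2 2 (2 ^ (n - 2)) \<rho>) powr \<beta>
         + ((1 + k) powr (\<beta> / s) - q powr (\<beta> / s)) / k powr (\<beta> / s)
           * negativity_assist 2 (2 ^ (n - 2)) (reduced_13 2 2 (2 ^ (n - 2)) \<rho>) powr \<beta>)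
    \<and>
   (negativity_assist 2 2 (reduced_12 2 2 (2 ^ (n - 2)) \<rho>) powr s
       \<ge> k * negativity_assist 2 (2 ^ (n - 2)) (reduced_13 2 2 (2 ^ (n - 2)) \<rho>) powr s \<longrightarrow>
     negativity_assist 2 (2 * 2 ^ (n - 2)) \<rho> powr \<beta>
       \<le> q powr (\<beta> / s) * negativity_assist 2 (2 ^ (n - 2)) (reduced_13 2 2 (2 ^ (n - 2)) \<rho>) powr \<beta>
         + ((1 + k) powr (\<beta> / s) - q powr (\<beta> / s)) / k powr (\<beta> / s)
           * negativity_assist 2 2 (reduced_12 2 2 (2 ^ (n - 2)) \<rho>) powr \<beta>)"
proof -
  define N where "N = (2 :: nat) ^ (n - 2)"
  let ?x = "negativity_assist 2 2 (reduced_12 2 2 N \<rho>)"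
    and ?y = "negativity_assist 2 N (reduced_13 2 2 N \<rho>)"
    and ?z = "negativity_assist 2 (2 * N) \<rho>"
  have pos: "0 < N" and psd: "psd (2 * (2 * N)) \<rho>"
    using assms(2) by (simp_all add: N_def density_def)
  have "0 \<le> ?x" "0 \<le> ?y" "0 \<le> ?z"
    using pos psd psd_reduced_12[OF psd] psd_reduced_13[OF psd]
    by (auto intro!: negativity_assist_nonneg)
  moreover have "?z \<le> ?x + ?y"
    using pos psd by (intro negativity_assist_polygamy) auto
  ultimately show ?thesis
    using assms(3-8) unfolding N_def[symmetric]
    by (intro conjI impI powr_le_weighted_if_le_add) (simp_all add: add.commute)
qed

end
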